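(* Let $T$ be a self-similar interval exchange map with associated substitution $\sigma$ and matrix $M$. Assume that $M$ has an eigenvalue $\beta$ with $|\beta|>1$ such that $\beta_0=\beta/|\beta|$ is not a root of unity, and that there exists an eigenvector $\Gamma$ of $M$ for $\beta$ such that $T$ has the unique representation property for $\beta$ and $\Gamma$. If $\gamma$ is a good eigenvector, then the set of minimal sequences $\omega\in\Omega_\sigma$ for $\gamma$ is finite.
   Context: **Self-similar i.e.m. and substitution.** Let $I=[0,1)$ and $\mathcal A$ a finite alphabet. An interval exchange map (i.e.m.) is a bijection $T\colon I\to I$ such that, for a partition $(I_a)_{a\in\mathcal A}$ of $I$ into (left-closed, right-open) intervals and a vector $\delta\in\mathbb R^{\mathcal A}$, $T(t)=t+\delta_a$ for $t\in I_a$. $T$ is self-similar (on $[0,\alpha)$, $0<\alpha<1$) if its first return map to $[0,\alpha)$ equals $T$ up to rescaling; it exchanges the intervals $I^{(1)}_a=\alpha I_a$, and $r_a$ is the first return time of $I_a^{(1)}$ to $[0,\alpha)$. The associated substitution $\sigma\colon\mathcal A\to\mathcal A^*\setminus\{\varepsilon\}$ ($\mathcal A^*$: finite words, $\varepsilon$: empty word) is given by $\sigma(a)=w_0\dots w_{r_a-1}$ where $T^m(I^{(1)}_a)\subseteq I_{w_m}$ for $0\le m\le r_a-1$ (it is part of the setting that this makes sense). $T$ is minimal and $\sigma$ is primitive. $M$ is the $\mathcal A\times\mathcal A$ matrix with $M_{a,b}$ = number of occurrences of $b$ in $\sigma(a)$. **Subshift and minimal sequences.** $\Omega_\sigma\subseteq\mathcal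 A^{\mathbb Z}$ is the set of two-sided sequences all of whose finite subwords are subwords of $\sigma^n(a)$ for some $n\ge0$, $a\in\mathcal A$. For $\gamma\in\mathbb C^{\mathcal A}$ and a word $w=w_0\dots w_{n-1}$ put $\gamma(w)=\gamma_{w_0}+\dots+\gamma_{w_{n-1}}$; for $\omega\in\Omega_\sigma$ put $\gamma_0(\omega)=0$, $\gamma_n(\omega)=\gamma(\omega_0\dots\omega_{n-1})$, $\gamma_{-n}(\omega)=-\gamma(\omega_{-n}\dots\omega_{-1})$ for $n\ge1$. $\omega$ is a minimal sequence for $\gamma$ if $\mathrm{Re}(\gamma_n(\omega))\ge0$ for all $n\in\mathbb Z$. **Fractals.** Let $\bar{\mathcal A}_a=\{(p,c,s)\in\mathcal A^*\times\mathcal A\times\mathcal A^*:\sigma(a)=pcs\}$ and $\bar{\mathcal A}=\bigcup_a\bar{\mathcal A}_a$ (labels). Let $\mathcal S_a$ be the set of sequences $x=(p^x_m,c^x_m,s^x_m)_{m\ge1}\in\bar{\mathcal A}^{\mathbb N}$ with $(p^x_1,c^x_1,s^x_1)\in\bar{\mathcal A}_a$ and $(p^x_{m+1},c^x_{m+1},s^x_{m+1})\in\bar{\mathcal A}_{c^x_m}$ for $m\ge1$; let $\mathcal S_{a,(p,c,s)}$ be those with first coordinate $(p,c,s)$. Put $z_a(x)=\sum_{m\ge1}\beta^{-m}\Gamma(p^x_m)$, $F_a=z_a(\mathcal S_a)$, $F_{a,(p,c,s)}=z_a(\mathcal S_{a,(p,c,s)})$ (compact subsets of $\mathbb C$). For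 $\tau\in\mathbb S^1$ (unit circle in $\mathbb C$) let $v_a(\tau)=\min_{z\in F_a}\mathrm{Re}(\tau z)$ and $v_{a,(p,c,s)}(\tau)=\min_{z\in F_{a,(p,c,s)}}\mathrm{Re}(\tau z)$. A point $z\in F_a$ is extreme for the direction $\tau$ if $\mathrm{Re}(\tau z)=v_a(\tau)$. **Unique representation property (u.r.p.)** for $\beta$ and $\Gamma$: for every $a\in\mathcal A$ and every extreme point $z\in F_a$ (for any direction) there is a unique $x\in\mathcal S_a$ with $z_a(x)=z$. **Good eigenvectors.** $\Psi_a$ is the set of $\tau\in\mathbb S^1$ such that $v_a(\tau)=v_{a,(p,c,s)}(\tau)=v_{a,(\bar p,\bar c,\bar s)}(\tau)$ for some different labels $(p,c,s),(\bar p,\bar c,\bar s)\in\bar{\mathcal A}_a$; $\Psi=\bigcup_a\Psi_a$. $\llbracket\tau-\tau'\rrbracket$ is the natural (arc-length) distance on $\mathbb S^1$. A direction $\tau\in\mathbb S^1$ is good if for some constant $1<A<|\beta|$ and every $\xi\in\Psi$, $\liminf_{n\to\infty}A^n\llbracket\xi-\beta_0^n\tau\rrbracket=\infty$. An eigenvector $\gamma$ of $M$ for $\beta$ is good if $\gamma=z\Gamma$ with $z\in\mathbb C\setminus\{0\}$ and $z/|z|$ a good direction. *)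

theory Defs
  imports "HOL-Analysis.Analysis" "HOL-Library.Sublist"
begin

section \<open>Self-similar interval exchange maps\<close>

text \<open>
  The alphabet is the finite type \<open>'a\<close>. Maps of \<open>[0,1)\<close> are total functions on the reals of
  which only the values on \<open>[0,1)\<close> matter.
\<close>

definition interval_exchange ::
  "(real \<Rightarrow> real) \<Rightarrow> ('a::finite \<Rightarrow> real set) \<Rightarrow> real ^ 'a \<Rightarrow> bool" where
  "interval_exchange T J \<delta> \<longleftrightarrow>
     bij_betw T {0..<1} {0..<1} \<and>
     (\<forall>a. \<exists>l r. l < r \<and> J a = {l..<r}) \<and>
     disjoint_family J \<and>
     (\<Union>a. J a) = {0..<1} \<and>
     (\<forall>a. \<forall>t\<in>J a. T t = t + \<delta> $ a)"

text \<open>Two-sided orbits; as \<open>T\<close> is a bijection of \<open>[0,1)\<close>, the backward half of the orbit of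
  \<open>t\<close> consists of the points having \<open>t\<close> in their forward orbit.\<close>

definition iem_orbit :: "(real \<Rightarrow> real) \<Rightarrow> real \<Rightarrow> real set" where
  "iem_orbit T t = {u \<in> {0..<1}. \<exists>n. (T ^^ n) t = u \<or> (T ^^ n) u = t}"

definition minimal_iem :: "(real \<Rightarrow> real) \<Rightarrow> bool" where
  "minimal_iem T \<longleftrightarrow> (\<forall>t\<in>{0..<1}. {0..<1} \<subseteq> closure (iem_orbit T t))"

definition return_time :: "(real \<Rightarrow> real) \<Rightarrow> real \<Rightarrow> real \<Rightarrow> nat" where
  "return_time T \<alpha> t = (LEAST n. 0 < n \<and> (T ^^ n) t \<in> {0..<\<alpha>})"

definition first_return_map :: "(real \<Rightarrow> real) \<Rightarrow> real \<Rightarrow> real \<Rightarrow> real" where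
  "first_return_map T \<alpha> t = (T ^^ return_time T \<alpha> t) t"

definition self_similar :: "(real \<Rightarrow> real) \<Rightarrow> real \<Rightarrow> bool" where
  "self_similar T \<alpha> \<longleftrightarrow>
     0 < \<alpha> \<and> \<alpha> < 1 \<and>
     (\<forall>t\<in>{0..<\<alpha>}. \<exists>n>0. (T ^^ n) t \<in> {0..<\<alpha>}) \<and>
     (\<forall>t\<in>{0..<1}. first_return_map T \<alpha> (\<alpha> * t) = \<alpha> * T t)"

text \<open>That the return time is constant on \<open>\<alpha> J a\<close>, and that each intermediate iterate of
  \<open>\<alpha> J a\<close> lies in a single exchanged interval, is part of this predicate.
  Given \<open>T\<close>, \<open>J\<close> and \<open>\<alpha>\<close>, it determines \<open>\<sigma>\<close>.\<close>

definition associated_substitution ::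
  "(real \<Rightarrow> real) \<Rightarrow> ('a \<Rightarrow> real set) \<Rightarrow> real \<Rightarrow> ('a \<Rightarrow> 'a list) \<Rightarrow> bool" where
  "associated_substitution T J \<alpha> \<sigma> \<longleftrightarrow>
     (\<forall>a. \<sigma> a \<noteq> [] \<and>
          (\<forall>t \<in> (*) \<alpha> ` J a. return_time T \<alpha> t = length (\<sigma> a)) \<and>
          (\<forall>m < length (\<sigma> a). (T ^^ m) ` ((*) \<alpha> ` J a) \<subseteq> J (\<sigma> a ! m)))"


section \<open>Substitutions\<close>

definition subst_word :: "('a \<Rightarrow> 'a list) \<Rightarrow> 'a list \<Rightarrow> 'a list" where
  "subst_word \<sigma> w = concat (map \<sigma> w)"

definition primitive_subst :: "('a \<Rightarrow> 'a list) \<Rightarrow> bool" where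
  "primitive_subst \<sigma> \<longleftrightarrow> (\<exists>n>0. \<forall>a b. b \<in> set ((subst_word \<sigma> ^^ n) [a]))"

definition subst_matrix :: "('a::finite \<Rightarrow> 'a list) \<Rightarrow> complex ^ 'a ^ 'a" where
  "subst_matrix \<sigma> = (\<chi> a b. of_nat (count_list (\<sigma> a) b))"

definition is_eigenvector :: "complex ^ 'a ^ 'a \<Rightarrow> complex \<Rightarrow> complex ^ 'a::finite \<Rightarrow> bool" where
  "is_eigenvector M \<beta> v \<longleftrightarrow> v \<noteq> 0 \<and> M *v v = \<beta> *s v"

definition subshift :: "('a \<Rightarrow> 'a list) \<Rightarrow> (int \<Rightarrow> 'a) set" where
  "subshift \<sigma> = {\<omega>. \<forall>i j. \<exists>n a. sublist (map \<omega> [i..j]) ((subst_word \<sigma> ^^ n) [a])}"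

definition word_sum :: "complex ^ 'a::finite \<Rightarrow> 'a list \<Rightarrow> complex" where
  "word_sum \<gamma> w = (\<Sum>a\<leftarrow>w. \<gamma> $ a)"

definition birkhoff_sum :: "complex ^ 'a::finite \<Rightarrow> (int \<Rightarrow> 'a) \<Rightarrow> int \<Rightarrow> complex" where
  "birkhoff_sum \<gamma> \<omega> n =
     (if 0 \<le> n then word_sum \<gamma> (map \<omega> [0..n - 1]) else - word_sum \<gamma> (map \<omega> [n..-1]))"

definition minimal_sequence :: "complex ^ 'a::finite \<Rightarrow> (int \<Rightarrow> 'a) \<Rightarrow> bool" where
  "minimal_sequence \<gamma> \<omega> \<longleftrightarrow> (\<forall>n. 0 \<le> Re (birkhoff_sum \<gamma> \<omega> n))"


section \<open>The fractals and the unique representation property\<close>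

type_synonym 'a label = "'a list \<times> 'a \<times> 'a list"

definition labels :: "('a \<Rightarrow> 'a list) \<Rightarrow> 'a \<Rightarrow> 'a label set" where
  "labels \<sigma> a = {(p, c, s). \<sigma> a = p @ [c] @ s}"

text \<open>Sequences \<open>(x\<^sub>m)\<close>, \<open>m \<ge> 1\<close>, are indexed from 0: the term \<open>x\<^sub>m\<close> is \<open>x (m - 1)\<close>.\<close>

definition label_seqs :: "('a \<Rightarrow> 'a list) \<Rightarrow> 'a \<Rightarrow> (nat \<Rightarrow> 'a label) set" where
  "label_seqs \<sigma> a =
     {x. x 0 \<in> labels \<sigma> a \<and> (\<forall>m. x (Suc m) \<in> labels \<sigma> (fst (snd (x m))))}"

definition label_seqs_from ::
  "('a \<Rightarrow> 'a list) \<Rightarrow> 'a \<Rightarrow> 'a label \<Rightarrow> (nat \<Rightarrow> 'a label) set" where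
  "label_seqs_from \<sigma> a l = {x \<in> label_seqs \<sigma> a. x 0 = l}"

definition rep_point :: "complex \<Rightarrow> complex ^ 'a::finite \<Rightarrow> (nat \<Rightarrow> 'a label) \<Rightarrow> complex" where
  "rep_point \<beta> \<Gamma> x = (\<Sum>m. word_sum \<Gamma> (fst (x m)) / \<beta> ^ Suc m)"

definition fractal ::
  "('a::finite \<Rightarrow> 'a list) \<Rightarrow> complex \<Rightarrow> complex ^ 'a \<Rightarrow> 'a \<Rightarrow> complex set" where
  "fractal \<sigma> \<beta> \<Gamma> a = rep_point \<beta> \<Gamma> ` label_seqs \<sigma> a"

definition fractal_from ::
  "('a::finite \<Rightarrow> 'a list) \<Rightarrow> complex \<Rightarrow> complex ^ 'a \<Rightarrow> 'a \<Rightarrow> 'a label \<Rightarrow> complex set" where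
  "fractal_from \<sigma> \<beta> \<Gamma> a l = rep_point \<beta> \<Gamma> ` label_seqs_from \<sigma> a l"

text \<open>The minimum of \<open>Re (\<tau> z)\<close> over \<open>F\<close>, which exists for nonempty compact \<open>F\<close>.\<close>

definition min_Re :: "complex \<Rightarrow> complex set \<Rightarrow> real" where
  "min_Re \<tau> F = (LEAST r. r \<in> (\<lambda>z. Re (\<tau> * z)) ` F)"

definition extreme_point :: "complex set \<Rightarrow> complex \<Rightarrow> complex \<Rightarrow> bool" where
  "extreme_point F \<tau> z \<longleftrightarrow> z \<in> F \<and> Re (\<tau> * z) = min_Re \<tau> F"

definition unique_representation_property ::
  "('a::finite \<Rightarrow> 'a list) \<Rightarrow> complex \<Rightarrow> complex ^ 'a \<Rightarrow> bool" where
  "unique_representation_property \<sigma> \<beta> \<Gamma> \<longleftrightarrow>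
     (\<forall>a. \<forall>\<tau>\<in>sphere 0 1. \<forall>z. extreme_point (fractal \<sigma> \<beta> \<Gamma> a) \<tau> z \<longrightarrow>
        (\<exists>!x. x \<in> label_seqs \<sigma> a \<and> rep_point \<beta> \<Gamma> x = z))"


section \<open>Good eigenvectors\<close>

definition Psi_at ::
  "('a::finite \<Rightarrow> 'a list) \<Rightarrow> complex \<Rightarrow> complex ^ 'a \<Rightarrow> 'a \<Rightarrow> complex set" where
  "Psi_at \<sigma> \<beta> \<Gamma> a =
     {\<tau> \<in> sphere 0 1. \<exists>l\<in>labels \<sigma> a. \<exists>l'\<in>labels \<sigma> a. l \<noteq> l' \<and>
        min_Re \<tau> (fractal \<sigma> \<beta> \<Gamma> a) = min_Re \<tau> (fractal_from \<sigma> \<beta> \<Gamma> a l) \<and>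
        min_Re \<tau> (fractal \<sigma> \<beta> \<Gamma> a) = min_Re \<tau> (fractal_from \<sigma> \<beta> \<Gamma> a l')}"

definition Psi :: "('a::finite \<Rightarrow> 'a list) \<Rightarrow> complex \<Rightarrow> complex ^ 'a \<Rightarrow> complex set" where
  "Psi \<sigma> \<beta> \<Gamma> = (\<Union>a. Psi_at \<sigma> \<beta> \<Gamma> a)"

text \<open>Arc-length distance on the unit circle; \<open>Arg\<close> takes values in \<open>(-\<pi>, \<pi>]\<close>.\<close>

definition arc_dist :: "complex \<Rightarrow> complex \<Rightarrow> real" where
  "arc_dist \<tau> \<tau>' = \<bar>Arg (\<tau> / \<tau>')\<bar>"

definition good_direction ::
  "('a::finite \<Rightarrow> 'a list) \<Rightarrow> complex \<Rightarrow> complex ^ 'a \<Rightarrow> complex \<Rightarrow> bool" where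
  "good_direction \<sigma> \<beta> \<Gamma> \<tau> \<longleftrightarrow>
     \<tau> \<in> sphere 0 1 \<and>
     (\<exists>A. 1 < A \<and> A < norm \<beta> \<and>
        (\<forall>\<xi>\<in>Psi \<sigma> \<beta> \<Gamma>.
           liminf (\<lambda>n. ereal (A ^ n * arc_dist \<xi> ((\<beta> / of_real (norm \<beta>)) ^ n * \<tau>))) = \<infinity>))"

definition good_eigenvector ::
  "('a::finite \<Rightarrow> 'a list) \<Rightarrow> complex \<Rightarrow> complex ^ 'a \<Rightarrow> complex ^ 'a \<Rightarrow> bool" where
  "good_eigenvector \<sigma> \<beta> \<Gamma> \<gamma> \<longleftrightarrow>
     is_eigenvector (subst_matrix \<sigma>) \<beta> \<gamma> \<and>
     (\<exists>z. z \<noteq> 0 \<and> \<gamma> = z *s \<Gamma> \<and> good_direction \<sigma> \<beta> \<Gamma> (z / of_real (norm z)))"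

end

theory Submission
  imports Defs "HOL-Library.Diagonal_Subsequence"
begin

text \<open>
  Write \<open>|w|\<close> for the length of a word, and let \<open>\<omega>\<close> be a minimal sequence for \<open>\<gamma> = z \<Gamma>\<close>. For
  every \<open>n\<close> the sequence \<open>\<omega>\<close> reads \<open>\<sigma>\<^sup>n(d) \<sigma>\<^sup>n(b) \<sigma>\<^sup>n(e)\<close> around the origin, for some letters
  \<open>d, b, e\<close>, with the origin at some position \<open>k\<close> of the middle block. Minimality of \<open>\<omega>\<close> says in
  particular that the prefix of length \<open>k\<close> minimizes \<open>Re \<gamma>\<close> among the proper prefixes of
  \<open>\<sigma>\<^sup>n(b)\<close>. The data \<open>(d, b, e, k)\<close> determine \<open>\<omega>\<close> at all distances less than the minimum of
  \<open>|\<sigma>\<^sup>n(a)|\<close> over \<open>a\<close> from the origin, and these minima are unbounded in \<open>n\<close>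
  (\<open>letter_images_grow\<close>). Hence the data for one large \<open>n\<close> tell the members of a given finite set of
  minimal sequences apart, and it suffices to bound the number of minimizing positions \<open>k\<close> uniformly
  in \<open>n\<close> and \<open>b\<close>. This is \<open>card_min_positions_bounded\<close>.

  For that bound, observe that a position in \<open>\<sigma>\<^bsup>n+1\<^esup>(b)\<close> lies in the block \<open>\<sigma>\<^sup>n(c)\<close> belonging to
  one label \<open>(p, c, s)\<close> of \<open>b\<close>, and that a minimizing position is also minimizing inside its block.
  So the number of minimizing positions cannot grow from \<open>n\<close> to \<open>n + 1\<close> if only one label of each
  letter carries any. It remains to see that this is the case for all large \<open>n\<close>.

  After division by \<open>\<beta>\<^sup>n\<close>, the \<open>\<Gamma>\<close>-values of the proper prefixes of \<open>\<sigma>\<^sup>n(b)\<close> approximate the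
  fractal \<open>F\<^sub>b\<close> with an error of order \<open>|\<beta>|\<^bsup>-n\<^esup>\<close>, and the positions in the block of a label \<open>l\<close>
  approximate the piece \<open>F\<^bsub>b,l\<^esub>\<close> in the same way. Put \<open>\<tau>\<^sub>n = \<beta>\<^sub>0\<^sup>n z/|z|\<close>. If two labels \<open>l\<close> and
  \<open>l'\<close> carry minimizing positions, then \<open>v\<^bsub>b,l\<^esub>(\<tau>\<^sub>n)\<close> and \<open>v\<^bsub>b,l'\<^esub>(\<tau>\<^sub>n)\<close> exceed \<open>v\<^sub>b(\<tau>\<^sub>n)\<close> by at
  most a constant times \<open>|\<beta>|\<^bsup>-n\<^esup>\<close>. Suppose that this near tie occurs for infinitely many \<open>n\<close>, with
  the same \<open>b, l, l'\<close>. A limit \<open>\<xi>\<close> of the corresponding \<open>\<tau>\<^sub>n\<close> is an exact tie, that is,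
  \<open>\<xi> \<in> \<Psi>\<^sub>b\<close>. By the unique representation property the points where \<open>F\<^bsub>b,l\<^esub>\<close> and \<open>F\<^bsub>b,l'\<^esub>\<close>
  attain the minimum in the direction \<open>\<xi>\<close> are different; they lie on one line \<open>Re (\<xi> z) = const\<close>.
  Therefore turning the direction away from \<open>\<xi>\<close> makes the two minima separate at a linear rate
  (\<open>support_functions_separate_linearly\<close>), and the distance of \<open>\<tau>\<^sub>n\<close> to \<open>\<xi>\<close> is at most a constant
  times \<open>|\<beta>|\<^bsup>-n\<^esup>\<close> for infinitely many \<open>n\<close>. A good direction excludes this, because its distance to
  \<open>\<xi>\<close> is eventually larger than any multiple of \<open>A\<^bsup>-n\<^esup>\<close>, where \<open>A < |\<beta>|\<close>.
\<close>


section \<open>Words under an iterated substitution\<close>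

lemma subst_pow_Nil: "(subst_word \<sigma> ^^ n) [] = []"
  by (induction n) (auto simp: subst_word_def)

lemma subst_pow_append:
  "(subst_word \<sigma> ^^ n) (u @ v) = (subst_word \<sigma> ^^ n) u @ (subst_word \<sigma> ^^ n) v"
  by (induction n) (auto simp: subst_word_def)

lemma subst_pow_Suc_letter: "(subst_word \<sigma> ^^ Suc n) [a] = (subst_word \<sigma> ^^ n) (\<sigma> a)"
  by (simp add: funpow_Suc_right subst_word_def del: funpow.simps)

lemma length_subst_word_ge:
  assumes "\<And>a. \<sigma> a \<noteq> []"
  shows "length w \<le> length (subst_word \<sigma> w)"
proof (induction w)
  case (Cons a w)
  have "length (\<sigma> a) \<ge> 1" using assms[of a] by (cases "\<sigma> a") auto
  then show ?case using Cons by (simp add: subst_word_def)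
qed (simp add: subst_word_def)

lemma length_subst_pow_mono:
  assumes "\<And>a. \<sigma> a \<noteq> []" and "m \<le> n"
  shows "length ((subst_word \<sigma> ^^ m) w) \<le> length ((subst_word \<sigma> ^^ n) w)"
  using assms(2)
proof (induction n rule: dec_induct)
  case (step n)
  then show ?case
    using length_subst_word_ge[of \<sigma> "(subst_word \<sigma> ^^ n) w"] assms(1) by simp
qed simp

text \<open>
  The word \<open>\<sigma>\<^sup>n(w)\<close> is the concatenation of the blocks \<open>\<sigma>\<^sup>n(c)\<close> over the letters \<open>c\<close> of \<open>w\<close>, so
  each of its positions is a position \<open>j\<close> in exactly one block.
\<close>

lemma subst_pow_locate:
  assumes "k < length ((subst_word \<sigma> ^^ n) w)"
  shows "\<exists>p c s j. w = p @ [c] @ s \<and> k = length ((subst_word \<sigma> ^^ n) p) + j \<and>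
           j < length ((subst_word \<sigma> ^^ n) [c])"
  using assms
proof (induction w arbitrary: k)
  case Nil
  then show ?case by (simp add: subst_pow_Nil)
next
  case (Cons a w)
  have split: "(subst_word \<sigma> ^^ n) (a # w) = (subst_word \<sigma> ^^ n) [a] @ (subst_word \<sigma> ^^ n) w"
    using subst_pow_append[of n \<sigma> "[a]" w] by simp
  show ?case
  proof (cases "k < length ((subst_word \<sigma> ^^ n) [a])")
    case True
    then show ?thesis
      by (intro exI[of _ "[]"] exI[of _ a] exI[of _ w] exI[of _ k]) (simp add: subst_pow_Nil)
  next
    case False
    define k' where "k' = k - length ((subst_word \<sigma> ^^ n) [a])"
    have "k' < length ((subst_word \<sigma> ^^ n) w)"
      using Cons.prems False by (simp add: split k'_def)
    then obtain p c s j where "w = p @ [c] @ s" "k' = length ((subst_word \<sigma> ^^ n) p) + j"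
        "j < length ((subst_word \<sigma> ^^ n) [c])"
      using Cons.IH by blast
    then show ?thesis
      using False subst_pow_append[of n \<sigma> "[a]" p]
      by (intro exI[of _ "a # p"] exI[of _ c] exI[of _ s] exI[of _ j]) (auto simp: k'_def)
  qed
qed

lemma finite_labels: "finite (labels \<sigma> a)"
proof -
  have "labels \<sigma> a \<subseteq>
      (\<lambda>k. (take k (\<sigma> a), \<sigma> a ! k, drop (Suc k) (\<sigma> a))) ` {..<length (\<sigma> a)}"
  proof
    fix l assume "l \<in> labels \<sigma> a"
    then obtain p c s where "l = (p, c, s)" "\<sigma> a = p @ [c] @ s"
      by (auto simp: labels_def)
    then show "l \<in> (\<lambda>k. (take k (\<sigma> a), \<sigma> a ! k, drop (Suc k) (\<sigma> a))) ` {..<length (\<sigma> a)}"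
      by (intro image_eqI[of _ _ "length p"]) auto
  qed
  then show ?thesis by (rule finite_subset) simp
qed

lemma word_sum_Nil [simp]: "word_sum \<gamma> [] = 0"
  by (simp add: word_sum_def)

lemma word_sum_append: "word_sum \<gamma> (u @ v) = word_sum \<gamma> u + word_sum \<gamma> v"
  by (simp add: word_sum_def)

lemma word_sum_scale: "word_sum (z *s \<Gamma>) w = z * word_sum \<Gamma> w"
  by (induction w) (auto simp: word_sum_def algebra_simps)

lemma word_sum_count: "word_sum \<gamma> w = (\<Sum>b\<in>UNIV. of_nat (count_list w b) * \<gamma> $ b)"
proof (induction w)
  case (Cons a w)
  have "(\<Sum>b\<in>UNIV. of_nat (count_list (a # w) b) * \<gamma> $ b) =
      (\<Sum>b\<in>UNIV. of_nat (count_list w b) * \<gamma> $ b + (if a = b then \<gamma> $ b else 0))"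
    by (intro sum.cong) (auto simp: algebra_simps)
  then show ?case using Cons by (simp add: sum.distrib word_sum_def)
qed (simp add: word_sum_def)

lemma norm_word_sum_le: "norm (word_sum \<gamma> w) \<le> (\<Sum>b\<leftarrow>w. norm (\<gamma> $ b))"
proof (induction w)
  case (Cons a w)
  then show ?case using norm_triangle_ineq[of "\<gamma> $ a" "word_sum \<gamma> w"] by (simp add: word_sum_def)
qed simp

text \<open>
  Evaluated on letters, the eigenvector equation says \<open>\<gamma>(\<sigma>(a)) = \<beta> \<gamma>(a)\<close>; this extends to words
  because both sides are additive under concatenation.
\<close>

lemma word_sum_subst_word:
  assumes "subst_matrix \<sigma> *v \<gamma> = \<beta> *s \<gamma>"
  shows "word_sum \<gamma> (subst_word \<sigma> w) = \<beta> * word_sum \<gamma> w"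
proof -
  have letter: "word_sum \<gamma> (\<sigma> a) = \<beta> * \<gamma> $ a" for a
  proof -
    have "word_sum \<gamma> (\<sigma> a) = (subst_matrix \<sigma> *v \<gamma>) $ a"
      by (simp add: word_sum_count matrix_vector_mult_def subst_matrix_def)
    then show ?thesis using assms by simp
  qed
  show ?thesis
    by (induction w)
      (simp_all add: subst_word_def word_sum_append letter, simp_all add: word_sum_def algebra_simps)
qed

lemma word_sum_subst_pow:
  assumes "subst_matrix \<sigma> *v \<gamma> = \<beta> *s \<gamma>"
  shows "word_sum \<gamma> ((subst_word \<sigma> ^^ n) w) = \<beta> ^ n * word_sum \<gamma> w"
  by (induction n) (simp_all add: word_sum_subst_word[OF assms])


section \<open>Minima of linear functionals over compact sets\<close>

lemma min_Re_attained:
  assumes "compact F" and "F \<noteq> {}"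
  shows "\<exists>z\<in>F. Re (\<tau> * z) = min_Re \<tau> F"
    and "w \<in> F \<Longrightarrow> min_Re \<tau> F \<le> Re (\<tau> * w)"
proof -
  have "continuous_on F (\<lambda>z. Re (\<tau> * z))"
    by (intro continuous_intros)
  then obtain z where z: "z \<in> F" "\<And>w. w \<in> F \<Longrightarrow> Re (\<tau> * z) \<le> Re (\<tau> * w)"
    using continuous_attains_inf[OF assms] by blast
  have eq: "min_Re \<tau> F = Re (\<tau> * z)"
    unfolding min_Re_def using z by (intro Least_equality) auto
  show "\<exists>z\<in>F. Re (\<tau> * z) = min_Re \<tau> F" using z eq by auto
  show "w \<in> F \<Longrightarrow> min_Re \<tau> F \<le> Re (\<tau> * w)" using z eq by auto
qed

text \<open>
  As \<open>F\<close> is bounded by some \<open>B\<close>, replacing \<open>\<tau>\<close> by \<open>\<tau>'\<close> changes \<open>Re (\<tau> z)\<close> by at most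
  \<open>B |\<tau> - \<tau>'|\<close> at each point of \<open>F\<close>, hence also the minimum.
\<close>

lemma min_Re_tendsto:
  assumes F: "compact F" "F \<noteq> {}" and t: "t \<longlonglongrightarrow> \<xi>"
  shows "(\<lambda>j. min_Re (t j) F) \<longlonglongrightarrow> min_Re \<xi> F"
proof -
  obtain B where B: "\<And>z. z \<in> F \<Longrightarrow> norm z \<le> B"
    using compact_imp_bounded[OF F(1)] unfolding bounded_iff by blast
  have one_sided: "min_Re \<tau> F - min_Re \<tau>' F \<le> B * norm (\<tau> - \<tau>')" for \<tau> \<tau>'
  proof -
    obtain z where z: "z \<in> F" "Re (\<tau>' * z) = min_Re \<tau>' F"
      using min_Re_attained(1)[OF F] by blast
    have "min_Re \<tau> F - min_Re \<tau>' F \<le> Re ((\<tau> - \<tau>') * z)"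
      using min_Re_attained(2)[OF F z(1), of \<tau>] z(2) by (simp add: algebra_simps)
    also have "\<dots> \<le> norm ((\<tau> - \<tau>') * z)" by (rule complex_Re_le_cmod)
    also have "\<dots> \<le> B * norm (\<tau> - \<tau>')"
      using mult_right_mono[OF B[OF z(1)], of "norm (\<tau> - \<tau>')"] by (simp add: norm_mult mult.commute)
    finally show ?thesis .
  qed
  have "(\<lambda>j. B * norm (t j - \<xi>)) \<longlonglongrightarrow> 0"
    using tendsto_mult_right_zero[OF tendsto_norm_zero[OF LIM_zero[OF t]]] by simp
  moreover have "\<forall>j. norm (min_Re (t j) F - min_Re \<xi> F) \<le> norm (B * norm (t j - \<xi>))"
  proof
    fix j
    have "\<bar>min_Re (t j) F - min_Re \<xi> F\<bar> \<le> B * norm (t j - \<xi>)"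
      using one_sided[of "t j" \<xi>] one_sided[of \<xi> "t j"] by (simp add: norm_minus_commute abs_le_iff)
    then show "norm (min_Re (t j) F - min_Re \<xi> F) \<le> norm (B * norm (t j - \<xi>))"
      by simp
  qed
  ultimately have "(\<lambda>j. min_Re (t j) F - min_Re \<xi> F) \<longlonglongrightarrow> 0"
    by (metis (no_types, lifting) Lim_transform_bound always_eventually)
  then show ?thesis by (rule LIM_zero_cancel)
qed

text \<open>
  Let \<open>t = \<xi> w\<close> with \<open>w\<close> on the unit circle near 1. Then
  \<open>Re (t z) = Re w Re (\<xi> z) - Im w Im (\<xi> z)\<close>, so the one-sided slopes of the minimum over \<open>G\<close> at
  \<open>\<xi>\<close> are values of \<open>- Im (\<xi> z)\<close> at points of \<open>G\<close> that are minimal for \<open>\<xi>\<close>, and likewise for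
  \<open>H\<close>. Minimal points of \<open>G\<close> and of \<open>H\<close> for \<open>\<xi>\<close> share the value of \<open>Re (\<xi> z)\<close>; being different,
  they differ in \<open>Im (\<xi> z)\<close>, so the slopes are different. Passing to a subsequence along which the
  minimal points for \<open>t j\<close> converge avoids a distinction between the two sides of \<open>\<xi>\<close>.
\<close>

lemma support_functions_separate_linearly:
  fixes t :: "nat \<Rightarrow> complex"
  assumes G: "compact G" "G \<noteq> {}" and H: "compact H" "H \<noteq> {}"
    and \<xi>: "norm \<xi> = 1" and t: "\<And>j. norm (t j) = 1" "t \<longlonglongrightarrow> \<xi>"
    and tie: "min_Re \<xi> G = min_Re \<xi> H"
    and disjoint: "\<And>z. z \<in> G \<Longrightarrow> z \<in> H \<Longrightarrow> Re (\<xi> * z) \<noteq> min_Re \<xi> G"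
  shows "\<exists>c>0. \<exists>r :: nat \<Rightarrow> nat. strict_mono r \<and>
    (\<forall>j. c * \<bar>Im (t (r j) / \<xi>)\<bar> \<le> \<bar>min_Re (t (r j)) G - min_Re (t (r j)) H\<bar>)"
proof -
  have "\<forall>j. \<exists>z. z \<in> G \<and> Re (t j * z) = min_Re (t j) G"
    using min_Re_attained(1)[OF G] by blast
  then obtain g where g: "\<And>j. g j \<in> G" "\<And>j. Re (t j * g j) = min_Re (t j) G"
    by metis
  have "\<forall>j. \<exists>z. z \<in> H \<and> Re (t j * z) = min_Re (t j) H"
    using min_Re_attained(1)[OF H] by blast
  then obtain h where h: "\<And>j. h j \<in> H" "\<And>j. Re (t j * h j) = min_Re (t j) H"
    by metis
  have "seq_compact (G \<times> H)"
    using compact_Times[OF G(1) H(1)] by (simp add: compact_eq_seq_compact_metric)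
  then obtain p r where p: "p \<in> G \<times> H" and r: "strict_mono r"
      and lim: "((\<lambda>j. (g j, h j)) \<circ> r) \<longlonglongrightarrow> p"
    using seq_compactE[of "G \<times> H" "\<lambda>j. (g j, h j)"] g(1) h(1) by auto
  obtain a b where p_eq: "p = (a, b)" by (cases p)
  have a: "a \<in> G" and b: "b \<in> H" using p p_eq by auto
  have ga: "(\<lambda>j. g (r j)) \<longlonglongrightarrow> a" and hb: "(\<lambda>j. h (r j)) \<longlonglongrightarrow> b"
    using tendsto_fst[OF lim] tendsto_snd[OF lim] p_eq by (auto simp: o_def)
  have tr: "(\<lambda>j. t (r j)) \<longlonglongrightarrow> \<xi>"
    using LIMSEQ_subseq_LIMSEQ[OF t(2) r] by (simp add: o_def)
  define m where "m = min_Re \<xi> G"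
  have "(\<lambda>j. Re (t (r j) * g (r j))) \<longlonglongrightarrow> Re (\<xi> * a)"
    by (intro tendsto_intros tr ga)
  moreover have "(\<lambda>j. Re (t (r j) * g (r j))) \<longlonglongrightarrow> m"
    using min_Re_tendsto[OF G tr] g(2) by (simp add: m_def)
  ultimately have Re_a: "Re (\<xi> * a) = m" by (rule LIMSEQ_unique)
  have "(\<lambda>j. Re (t (r j) * h (r j))) \<longlonglongrightarrow> Re (\<xi> * b)"
    by (intro tendsto_intros tr hb)
  moreover have "(\<lambda>j. Re (t (r j) * h (r j))) \<longlonglongrightarrow> m"
    using min_Re_tendsto[OF H tr] h(2) tie by (simp add: m_def)
  ultimately have Re_b: "Re (\<xi> * b) = m" by (rule LIMSEQ_unique)
  have "a \<noteq> b" using disjoint[of a] a b Re_a m_def by auto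
  then have "\<xi> * a \<noteq> \<xi> * b" using \<xi> by auto
  then have Im_ne: "Im (\<xi> * a) \<noteq> Im (\<xi> * b)" using Re_a Re_b complex_eqI by metis
  \<comment> \<open>The difference of the two slopes.\<close>
  define D where "D = Im (\<xi> * a) - Im (\<xi> * b)"
  have D: "D \<noteq> 0" using Im_ne D_def by simp
  then have D2: "0 < \<bar>D\<bar> / 2" by simp
  define w where "w j = t (r j) / \<xi>" for j
  have \<xi>0: "\<xi> \<noteq> 0" using \<xi> by auto
  have "w \<longlonglongrightarrow> \<xi> / \<xi>" unfolding w_def by (intro tendsto_intros tr \<xi>0)
  then have "(\<lambda>j. Re (w j)) \<longlonglongrightarrow> 1" using tendsto_Re[of w "\<xi> / \<xi>"] \<xi>0 by simp
  then have ev1: "\<forall>\<^sub>F j in sequentially. Re (w j) > 0"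
    by (rule order_tendstoD) simp
  have "(\<lambda>j. Im (\<xi> * g (r j))) \<longlonglongrightarrow> Im (\<xi> * a)" by (intro tendsto_intros ga)
  from tendstoD[OF this D2] have ev2: "\<forall>\<^sub>F j in sequentially. \<bar>Im (\<xi> * g (r j)) - Im (\<xi> * a)\<bar> < \<bar>D\<bar> / 2"
    unfolding dist_real_def .
  have "(\<lambda>j. Im (\<xi> * h (r j))) \<longlonglongrightarrow> Im (\<xi> * b)" by (intro tendsto_intros hb)
  from tendstoD[OF this D2] have ev3: "\<forall>\<^sub>F j in sequentially. \<bar>Im (\<xi> * h (r j)) - Im (\<xi> * b)\<bar> < \<bar>D\<bar> / 2"
    unfolding dist_real_def .
  obtain N where N: "\<And>j. j \<ge> N \<Longrightarrow> Re (w j) > 0"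
      "\<And>j. j \<ge> N \<Longrightarrow> \<bar>Im (\<xi> * g (r j)) - Im (\<xi> * a)\<bar> < \<bar>D\<bar> / 2"
      "\<And>j. j \<ge> N \<Longrightarrow> \<bar>Im (\<xi> * h (r j)) - Im (\<xi> * b)\<bar> < \<bar>D\<bar> / 2"
    using eventually_conj[OF ev1 eventually_conj[OF ev2 ev3]]
    unfolding eventually_sequentially by blast
  have expand: "Re (t (r j) * z) = Re (w j) * Re (\<xi> * z) - Im (w j) * Im (\<xi> * z)" for j z
  proof -
    have "t (r j) * z = w j * (\<xi> * z)" using \<xi>0 by (simp add: w_def)
    then show ?thesis by (simp only: times_complex.simps)
  qed
  have bound: "\<bar>D\<bar> / 2 * \<bar>Im (w j)\<bar> \<le> \<bar>min_Re (t (r j)) G - min_Re (t (r j)) H\<bar>" if j: "j \<ge> N" for j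
  proof -
    define y where "y = Im (w j)"
    define e where "e = Im (\<xi> * g (r j)) - Im (\<xi> * a)"
    define f where "f = Im (\<xi> * h (r j)) - Im (\<xi> * b)"
    have small: "\<bar>y * e\<bar> \<le> \<bar>D\<bar> / 2 * \<bar>y\<bar>" "\<bar>y * f\<bar> \<le> \<bar>D\<bar> / 2 * \<bar>y\<bar>"
      using N(2,3)[OF j] mult_right_mono[of "\<bar>e\<bar>" "\<bar>D\<bar> / 2" "\<bar>y\<bar>"]
        mult_right_mono[of "\<bar>f\<bar>" "\<bar>D\<bar> / 2" "\<bar>y\<bar>"]
      by (simp_all add: abs_mult e_def f_def mult.commute)
    have Re_ge: "Re (w j) * m \<le> Re (w j) * Re (\<xi> * g (r j))"
        "Re (w j) * m \<le> Re (w j) * Re (\<xi> * h (r j))"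
    proof -
      have "m \<le> Re (\<xi> * g (r j))" "m \<le> Re (\<xi> * h (r j))"
        using min_Re_attained(2)[OF G g(1)] min_Re_attained(2)[OF H h(1)] tie
        unfolding m_def by metis+
      then show "Re (w j) * m \<le> Re (w j) * Re (\<xi> * g (r j))"
          "Re (w j) * m \<le> Re (w j) * Re (\<xi> * h (r j))"
        using N(1)[OF j] by (auto intro!: mult_left_mono simp del: times_complex.simps)
    qed
    \<comment> \<open>Each minimum is bounded above by testing it with the limit point, and below by the minimal
      point for \<open>t (r j)\<close>. The two resulting lower bounds have main terms \<open>y D\<close> and \<open>- y D\<close>, and
      whichever is nonnegative gives the claim.\<close>
    have "min_Re (t (r j)) G \<le> Re (w j) * m - y * Im (\<xi> * a)"
      using min_Re_attained(2)[OF G a, of "t (r j)"] expand Re_a by (simp add: y_def)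
    moreover have "min_Re (t (r j)) H \<ge> Re (w j) * m - y * (Im (\<xi> * b) + f)"
      using h(2)[of "r j"] expand[of j "h (r j)"] Re_ge(2) by (simp add: y_def f_def)
    ultimately have 1: "min_Re (t (r j)) H - min_Re (t (r j)) G \<ge> y * D - y * f"
      by (simp add: D_def algebra_simps)
    have "min_Re (t (r j)) H \<le> Re (w j) * m - y * Im (\<xi> * b)"
      using min_Re_attained(2)[OF H b, of "t (r j)"] expand Re_b by (simp add: y_def)
    moreover have "min_Re (t (r j)) G \<ge> Re (w j) * m - y * (Im (\<xi> * a) + e)"
      using g(2)[of "r j"] expand[of j "g (r j)"] Re_ge(1) by (simp add: y_def e_def)
    ultimately have 2: "min_Re (t (r j)) G - min_Re (t (r j)) H \<ge> - (y * D) - y * e"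
      by (simp add: D_def algebra_simps)
    have "\<bar>y * D\<bar> = \<bar>D\<bar> * \<bar>y\<bar>" by (simp add: abs_mult)
    moreover have "\<bar>D\<bar> / 2 * \<bar>y\<bar> = \<bar>D\<bar> * \<bar>y\<bar> / 2" by simp
    ultimately show ?thesis using 1 2 small unfolding y_def[symmetric] by linarith
  qed
  show ?thesis
  proof (rule exI[of _ "\<bar>D\<bar> / 2"], rule conjI, goal_cases)
  case 1 show ?case by (rule D2)
  next case 2 show ?case
  proof (rule exI[of _ "\<lambda>j. r (j + N)"], intro conjI allI)
    show "strict_mono (\<lambda>j. r (j + N))" using r by (simp add: strict_mono_def)
    show "\<bar>D\<bar> / 2 * \<bar>Im (t (r (j + N)) / \<xi>)\<bar>
        \<le> \<bar>min_Re (t (r (j + N))) G - min_Re (t (r (j + N))) H\<bar>" for j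
      using bound[of "j + N"] unfolding w_def by simp
  qed
  qed
qed

text \<open>
  For the angle \<open>t\<close> between the two directions, \<open>|t| \<le> |tan t| = |sin t| / cos t\<close>, where the cosine
  is at least \<open>1 / 2\<close>.
\<close>

lemma arc_dist_le_Im:
  assumes "norm \<xi> = 1" "norm \<tau> = 1" and "Re (\<tau> / \<xi>) \<ge> 1 / 2"
  shows "arc_dist \<xi> \<tau> \<le> 2 * \<bar>Im (\<tau> / \<xi>)\<bar>"
proof -
  define v where "v = \<xi> / \<tau>"
  have nv: "norm v = 1" using assms by (simp add: v_def norm_divide)
  have "\<tau> / \<xi> = inverse v" by (simp add: v_def)
  also have "\<dots> = cnj v" using nv complex_div_cnj[of 1 v] by (simp add: divide_inverse)
  finally have inv: "\<tau> / \<xi> = cnj v" .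
  have "v \<noteq> 0" using nv by auto
  then have cs: "cos (Arg v) = Re v" "sin (Arg v) = Im v"
    using nv by (simp_all add: cos_Arg sin_Arg)
  have "\<bar>Arg v\<bar> < pi / 2"
    using assms(3) inv by (subst Arg_Re_pos) simp
  then have "\<bar>Arg v\<bar> \<le> \<bar>tan (Arg v)\<bar>" by (rule abs_tan_ge)
  also have "\<dots> = \<bar>Im v\<bar> / Re v" using cs inv assms(3) by (simp add: tan_def)
  also have "\<dots> \<le> \<bar>Im v\<bar> / (1/2)"
    using assms(3) inv by (intro divide_left_mono) auto
  finally show ?thesis unfolding arc_dist_def v_def[symmetric] inv by simp
qed


section \<open>Compactness of the fractals\<close>

lemma label_seqs_label:
  assumes "x \<in> label_seqs \<sigma> a"
  shows "\<exists>b. x m \<in> labels \<sigma> b"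
  using assms by (cases m) (auto simp: label_seqs_def)

lemma label_seqs_shift:
  assumes "x \<in> label_seqs \<sigma> a"
  shows "(\<lambda>m. x (Suc m)) \<in> label_seqs \<sigma> (fst (snd (x 0)))"
  using assms by (auto simp: label_seqs_def)

lemma label_seqs_from_cons:
  assumes "l \<in> labels \<sigma> a" and "y \<in> label_seqs \<sigma> (fst (snd l))"
  shows "case_nat l y \<in> label_seqs_from \<sigma> a l"
  using assms by (auto simp: label_seqs_def label_seqs_from_def split: nat.split)

lemma label_seqs_split: "label_seqs \<sigma> a = (\<Union>l\<in>labels \<sigma> a. label_seqs_from \<sigma> a l)"
  by (auto simp: label_seqs_def label_seqs_from_def)

lemma fractal_split: "fractal \<sigma> \<beta> \<Gamma> a = (\<Union>l\<in>labels \<sigma> a. fractal_from \<sigma> \<beta> \<Gamma> a l)"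
  unfolding fractal_def fractal_from_def by (subst label_seqs_split) blast

text \<open>
  Under \<open>\<Gamma>\<close>, applying the substitution multiplies the value of a word by \<open>\<beta>\<close>; as \<open>|\<beta>| > 1\<close>, the
  series that define the points of the fractals converge.
\<close>

locale expanding_eigenvector =
  fixes \<sigma> :: "'a::finite \<Rightarrow> 'a list" and \<beta> :: complex and \<Gamma> :: "complex ^ 'a"
  assumes nonempty: "\<sigma> a \<noteq> []"
    and expanding: "norm \<beta> > 1"
    and eigen: "subst_matrix \<sigma> *v \<Gamma> = \<beta> *s \<Gamma>"
begin

lemma \<beta>_nonzero: "\<beta> \<noteq> 0"
  using expanding by auto

lemma inverse_norm_less_1: "1 / norm \<beta> < 1"
  using expanding less_trans[OF zero_less_one expanding] by (simp only: divide_less_eq_1_pos)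

lemma label_seqs_nonempty: "label_seqs \<sigma> a \<noteq> {}"
proof -
  define f where "f b = ([] :: 'a list, hd (\<sigma> b), tl (\<sigma> b))" for b
  have f: "f b \<in> labels \<sigma> b" for b
    using nonempty by (simp add: f_def labels_def)
  define g where "g b = fst (snd (f b))" for b
  have "(\<lambda>m. f ((g ^^ m) a)) \<in> label_seqs \<sigma> a"
    using f by (auto simp: label_seqs_def g_def)
  then show ?thesis by blast
qed

text \<open>
  The numerator bounds \<open>|\<Gamma>(p)|\<close> for every label \<open>(p, c, s)\<close>, so this is the sum of a geometric
  series that dominates every series \<open>z\<^sub>a(x)\<close>.
\<close>

definition radius :: real where
  "radius = (\<Sum>a\<in>UNIV. \<Sum>b\<leftarrow>\<sigma> a. norm (\<Gamma> $ b)) / (norm \<beta> - 1)"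

lemma rep_point_terms:
  assumes "x \<in> label_seqs \<sigma> a"
  shows "summable (\<lambda>m. word_sum \<Gamma> (fst (x m)) / \<beta> ^ Suc m)"
    and "norm (rep_point \<beta> \<Gamma> x) \<le> radius"
proof -
  define B where "B = (\<Sum>a\<in>UNIV. \<Sum>b\<leftarrow>\<sigma> a. norm (\<Gamma> $ b))"
  have word_le: "norm (word_sum \<Gamma> (fst (x m))) \<le> B" for m
  proof -
    obtain b where "x m \<in> labels \<sigma> b" using label_seqs_label[OF assms] by blast
    then obtain p c s where pcs: "x m = (p, c, s)" "\<sigma> b = p @ [c] @ s" by (auto simp: labels_def)
    have "norm (word_sum \<Gamma> p) \<le> (\<Sum>b\<leftarrow>p. norm (\<Gamma> $ b))" by (rule norm_word_sum_le)
    also have "\<dots> \<le> (\<Sum>b\<leftarrow>\<sigma> b. norm (\<Gamma> $ b))"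
      using pcs by (auto intro!: add_nonneg_nonneg sum_list_nonneg)
    also have "\<dots> \<le> B" unfolding B_def
      by (rule member_le_sum) (auto intro!: sum_list_nonneg)
    finally show ?thesis using pcs by simp
  qed
  have terms: "norm (word_sum \<Gamma> (fst (x m)) / \<beta> ^ Suc m) \<le> B / norm \<beta> * (1 / norm \<beta>) ^ m" for m
  proof -
    have "norm (word_sum \<Gamma> (fst (x m)) / \<beta> ^ Suc m) \<le> B / norm \<beta> ^ Suc m"
      unfolding norm_divide norm_power using word_le[of m] by (intro divide_right_mono) auto
    then show ?thesis by (simp add: power_one_over field_simps)
  qed
  have geom: "(\<lambda>m. B / norm \<beta> * (1 / norm \<beta>) ^ m) sums (B / norm \<beta> * (1 / (1 - 1 / norm \<beta>)))"
    using inverse_norm_less_1 by (intro sums_mult geometric_sums) simp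
  have limit: "B / norm \<beta> * (1 / (1 - 1 / norm \<beta>)) = radius"
    using expanding by (auto simp: radius_def B_def[symmetric] field_simps)
  show "summable (\<lambda>m. word_sum \<Gamma> (fst (x m)) / \<beta> ^ Suc m)"
    by (rule summable_comparison_test'[OF sums_summable[OF geom]]) (use terms in simp)
  show "norm (rep_point \<beta> \<Gamma> x) \<le> radius"
    unfolding rep_point_def limit[symmetric] sums_unique[OF geom]
    by (rule norm_suminf_le[OF terms sums_summable[OF geom]])
qed

lemma radius_nonneg: "radius \<ge> 0"
  using expanding unfolding radius_def
  by (intro divide_nonneg_pos sum_nonneg sum_list_nonneg) auto

text \<open>
  The self-similarity of the fractals: \<open>F\<^bsub>b,(p,c,s)\<^esub> = \<beta>\<^bsup>-1\<^esup> (\<Gamma>(p) + F\<^sub>c)\<close>.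
\<close>

lemma rep_point_shift:
  assumes "x \<in> label_seqs \<sigma> a"
  shows "rep_point \<beta> \<Gamma> x =
    (word_sum \<Gamma> (fst (x 0)) + rep_point \<beta> \<Gamma> (\<lambda>m. x (Suc m))) / \<beta>"
proof -
  note summable = rep_point_terms(1)[OF assms] rep_point_terms(1)[OF label_seqs_shift[OF assms]]
  have "rep_point \<beta> \<Gamma> x = word_sum \<Gamma> (fst (x 0)) / \<beta> +
      (\<Sum>m. word_sum \<Gamma> (fst (x (Suc m))) / \<beta> ^ Suc (Suc m))"
    unfolding rep_point_def using suminf_split_head[OF summable(1)] by simp
  also have "(\<Sum>m. word_sum \<Gamma> (fst (x (Suc m))) / \<beta> ^ Suc (Suc m)) =
      rep_point \<beta> \<Gamma> (\<lambda>m. x (Suc m)) / \<beta>"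
    unfolding rep_point_def using suminf_divide[OF summable(2), of \<beta>]
    by (simp add: mult.commute mult.left_commute)
  finally show ?thesis by (simp add: add_divide_distrib)
qed

text \<open>
  Each common first label contributes a common translation and a contraction by \<open>\<beta>\<^bsup>-1\<^esup>\<close>.
\<close>

lemma rep_point_agree:
  assumes "x \<in> label_seqs \<sigma> a" "y \<in> label_seqs \<sigma> a" and "\<And>m. m < n \<Longrightarrow> x m = y m"
  shows "norm (rep_point \<beta> \<Gamma> x - rep_point \<beta> \<Gamma> y) \<le> 2 * radius / norm \<beta> ^ n"
  using assms
proof (induction n arbitrary: x y a)
  case 0
  have "norm (rep_point \<beta> \<Gamma> x - rep_point \<beta> \<Gamma> y) \<le> radius + radius"
    using 0 by (intro norm_triangle_le_diff add_mono rep_point_terms(2))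
  then show ?case by simp
next
  case (Suc n)
  have "norm (rep_point \<beta> \<Gamma> (\<lambda>m. x (Suc m)) - rep_point \<beta> \<Gamma> (\<lambda>m. y (Suc m)))
      \<le> 2 * radius / norm \<beta> ^ n"
    using label_seqs_shift[OF Suc.prems(1)] label_seqs_shift[OF Suc.prems(2)] Suc.prems(3)
    by (intro Suc.IH) auto
  moreover have "rep_point \<beta> \<Gamma> x - rep_point \<beta> \<Gamma> y =
      (rep_point \<beta> \<Gamma> (\<lambda>m. x (Suc m)) - rep_point \<beta> \<Gamma> (\<lambda>m. y (Suc m))) / \<beta>"
    using rep_point_shift[OF Suc.prems(1)] rep_point_shift[OF Suc.prems(2)] Suc.prems(3)[of 0]
    by (simp add: diff_divide_distrib[symmetric])
  ultimately have "norm (rep_point \<beta> \<Gamma> x - rep_point \<beta> \<Gamma> y)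
      \<le> 2 * radius / norm \<beta> ^ n / norm \<beta>"
    by (simp only: norm_divide divide_right_mono norm_ge_zero)
  then show ?case by (simp add: mult.commute)
qed

text \<open>
  There are only finitely many labels, so a sequence of label sequences has, by a diagonal argument, a
  subsequence each of whose coordinates is eventually constant. The constants form an admissible
  label sequence, and by \<open>rep_point_agree\<close> the represented points converge.
\<close>

lemma compact_fractal_from: "compact (fractal_from \<sigma> \<beta> \<Gamma> a l)"
  unfolding compact_eq_seq_compact_metric
proof (rule seq_compactI)
  fix f :: "nat \<Rightarrow> complex"
  assume "\<forall>n. f n \<in> fractal_from \<sigma> \<beta> \<Gamma> a l"
  then have "\<forall>n. \<exists>x. x \<in> label_seqs_from \<sigma> a l \<and> f n = rep_point \<beta> \<Gamma> x"
    by (auto simp: fractal_from_def)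
  then obtain X where X: "\<And>n. X n \<in> label_seqs_from \<sigma> a l"
      and f: "\<And>n. f n = rep_point \<beta> \<Gamma> (X n)"
    by metis
  have X_seq: "X n \<in> label_seqs \<sigma> a" for n
    using X by (simp add: label_seqs_from_def)
  define P where "P m s \<longleftrightarrow> (\<exists>v. \<forall>j. X (s j) m = v)" for m and s :: "nat \<Rightarrow> nat"
  have finite_range: "finite (range (\<lambda>n. X n m))" for m
  proof (rule finite_subset)
    show "range (\<lambda>n. X n m) \<subseteq> (\<Union>b. labels \<sigma> b)"
      using label_seqs_label[OF X_seq] by blast
  qed (simp add: finite_labels)
  \<comment> \<open>\<open>P m s\<close> says that coordinate \<open>m\<close> is constant along the subsequence \<open>s\<close>.\<close>
  interpret subseqs P
  proof
    fix m and s :: "nat \<Rightarrow> nat"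
    assume "strict_mono s"
    have "finite (range (\<lambda>j. X (s j) m))"
      by (rule finite_subset[OF _ finite_range[of m]]) auto
    then obtain i where "infinite {j \<in> UNIV. X (s j) m = X (s i) m}"
      using pigeonhole_infinite[of UNIV "\<lambda>j. X (s j) m"] by blast
    then have "infinite {j. X (s j) m = X (s i) m}" by simp
    then obtain r' :: "nat \<Rightarrow> nat" where "strict_mono r'" "\<forall>j. r' j \<in> {j. X (s j) m = X (s i) m}"
      using infinite_enumerate by blast
    then show "\<exists>r'. strict_mono r' \<and> P m (s \<circ> r')"
      unfolding P_def by (intro exI[of _ r'] conjI exI[of _ "X (s i) m"]) auto
  qed
  have diag: "P m (diagseq \<circ> ((+) (Suc m)))" for m
    by (rule diagseq_holds) (auto simp: P_def)
  \<comment> \<open>Coordinate \<open>m\<close> is constant along the diagonal sequence only from index \<open>m + 1\<close> on.\<close>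
  define y where "y m = X (diagseq (Suc m)) m" for m
  have y: "X (diagseq j) m = y m" if "j > m" for j m
  proof -
    obtain v where v: "\<And>i. X (diagseq (Suc m + i)) m = v" using diag[of m] by (auto simp: P_def)
    show ?thesis using v[of "j - Suc m"] v[of 0] that by (simp add: y_def)
  qed
  have y_seq: "y \<in> label_seqs_from \<sigma> a l"
    unfolding label_seqs_from_def label_seqs_def
  proof (intro CollectI conjI allI)
    have "X (diagseq 1) 0 = y 0" using y by simp
    then show "y 0 \<in> labels \<sigma> a" "y 0 = l"
      using X[of "diagseq 1"] by (auto simp: label_seqs_from_def label_seqs_def)
    fix m
    have "X (diagseq (Suc (Suc m))) m = y m" "X (diagseq (Suc (Suc m))) (Suc m) = y (Suc m)"
      using y by simp_all
    then show "y (Suc m) \<in> labels \<sigma> (fst (snd (y m)))"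
      using X_seq[of "diagseq (Suc (Suc m))"] unfolding label_seqs_def
      by (metis (mono_tags, lifting) mem_Collect_eq)
  qed
  have "(\<lambda>j. 2 * radius * (1 / norm \<beta>) ^ j) \<longlonglongrightarrow> 2 * radius * 0"
    using inverse_norm_less_1 by (intro tendsto_mult_left LIMSEQ_realpow_zero) auto
  then have "(\<lambda>j. 2 * radius * (1 / norm \<beta>) ^ j) \<longlonglongrightarrow> 0" by simp
  moreover have "\<forall>j. norm (f (diagseq j) - rep_point \<beta> \<Gamma> y)
      \<le> norm (2 * radius * (1 / norm \<beta>) ^ j)"
  proof
    fix j
    have "norm (f (diagseq j) - rep_point \<beta> \<Gamma> y) \<le> 2 * radius / norm \<beta> ^ j"
      unfolding f using X_seq y_seq y
      by (intro rep_point_agree) (auto simp: label_seqs_from_def)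
    also have "\<dots> = norm (2 * radius * (1 / norm \<beta>) ^ j)"
      using radius_nonneg by (simp add: power_one_over norm_mult norm_power norm_divide)
    finally show "norm (f (diagseq j) - rep_point \<beta> \<Gamma> y) \<le> norm (2 * radius * (1 / norm \<beta>) ^ j)" .
  qed
  ultimately have "(\<lambda>j. f (diagseq j) - rep_point \<beta> \<Gamma> y) \<longlonglongrightarrow> 0"
    by (metis (no_types, lifting) Lim_transform_bound always_eventually)
  then have "(f \<circ> diagseq) \<longlonglongrightarrow> rep_point \<beta> \<Gamma> y"
    using LIM_zero_cancel by (simp add: o_def) 
  then show "\<exists>l'\<in>fractal_from \<sigma> \<beta> \<Gamma> a l. \<exists>r. strict_mono r \<and> (f \<circ> r) \<longlonglongrightarrow> l'"
    using y_seq subseq_diagseq by (auto simp: fractal_from_def)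
qed

lemma fractal_from_nonempty:
  assumes "l \<in> labels \<sigma> a"
  shows "fractal_from \<sigma> \<beta> \<Gamma> a l \<noteq> {}"
  using label_seqs_from_cons[OF assms] label_seqs_nonempty[of "fst (snd l)"]
  by (auto simp: fractal_from_def)

lemma compact_fractal: "compact (fractal \<sigma> \<beta> \<Gamma> a)"
  unfolding fractal_split by (intro compact_UN finite_labels compact_fractal_from)

lemma fractal_nonempty: "fractal \<sigma> \<beta> \<Gamma> a \<noteq> {}"
  using label_seqs_nonempty by (auto simp: fractal_def)

end


section \<open>Minimizing positions in the images of letters\<close>

definition min_positions :: "('a \<Rightarrow> 'a list) \<Rightarrow> complex ^ 'a::finite \<Rightarrow> nat \<Rightarrow> 'a \<Rightarrow> nat set" where
  "min_positions \<sigma> \<gamma> n b = {k. k < length ((subst_word \<sigma> ^^ n) [b]) \<and>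
     (\<forall>j<length ((subst_word \<sigma> ^^ n) [b]).
        Re (word_sum \<gamma> (take k ((subst_word \<sigma> ^^ n) [b])))
          \<le> Re (word_sum \<gamma> (take j ((subst_word \<sigma> ^^ n) [b]))))}"

lemma finite_min_positions: "finite (min_positions \<sigma> \<gamma> n b)"
  by (rule finite_subset[of _ "{..<length ((subst_word \<sigma> ^^ n) [b])}"])
    (auto simp: min_positions_def)

lemma Re_scaled_close:
  fixes z :: complex
  assumes "norm (u - v) \<le> C"
  shows "\<bar>Re (z * u) - Re (z * v)\<bar> \<le> norm z * C"
proof -
  have "\<bar>Re (z * u) - Re (z * v)\<bar> \<le> norm (z * (u - v))"
    using abs_Re_le_cmod[of "z * (u - v)"] by (simp add: right_diff_distrib)
  also have "\<dots> \<le> norm z * C"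
    using assms by (auto simp: norm_mult intro: mult_left_mono)
  finally show ?thesis .
qed

context expanding_eigenvector
begin

text \<open>
  In the block of \<open>\<sigma>\<^bsup>n+1\<^esup>(b)\<close> that belongs to the label \<open>(p, c, s)\<close>, prefix values are those of
  \<open>\<sigma>\<^sup>n(c)\<close> translated by \<open>\<beta>\<^sup>n \<Gamma>(p)\<close>. The rescaled fractals satisfy the same recursion
  (\<open>rep_point_level\<close>), with the same translation. Hence the distance between a prefix value and a
  fractal point built from the same labels does not change with \<open>n\<close>, and stays at most \<open>radius\<close>.
\<close>

lemma word_sum_take_level:
  assumes "\<sigma> b = p @ [c] @ s" and "j \<le> length ((subst_word \<sigma> ^^ n) [c])"
  shows "word_sum \<Gamma> (take (length ((subst_word \<sigma> ^^ n) p) + j) ((subst_word \<sigma> ^^ Suc n) [b])) =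
    \<beta> ^ n * word_sum \<Gamma> p + word_sum \<Gamma> (take j ((subst_word \<sigma> ^^ n) [c]))"
proof -
  have "(subst_word \<sigma> ^^ Suc n) [b] =
      (subst_word \<sigma> ^^ n) p @ (subst_word \<sigma> ^^ n) [c] @ (subst_word \<sigma> ^^ n) s"
    using assms(1) by (simp only: subst_pow_Suc_letter subst_pow_append)
  then show ?thesis
    using assms(2) by (simp add: word_sum_append word_sum_subst_pow[OF eigen])
qed

lemma level_position_less:
  assumes "\<sigma> b = p @ [c] @ s" and "j < length ((subst_word \<sigma> ^^ n) [c])"
  shows "length ((subst_word \<sigma> ^^ n) p) + j < length ((subst_word \<sigma> ^^ Suc n) [b])"
  unfolding subst_pow_Suc_letter assms(1) subst_pow_append using assms(2) by simp

lemma level_position_exists: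
  assumes "k < length ((subst_word \<sigma> ^^ Suc n) [b])"
  shows "\<exists>p c s j. (p, c, s) \<in> labels \<sigma> b \<and> k = length ((subst_word \<sigma> ^^ n) p) + j \<and>
           j < length ((subst_word \<sigma> ^^ n) [c])"
  using subst_pow_locate[of k n \<sigma> "\<sigma> b"] assms
  unfolding subst_pow_Suc_letter labels_def by simp

lemma rep_point_level:
  assumes "x \<in> label_seqs_from \<sigma> b (p, c, s)"
  shows "\<beta> ^ Suc n * rep_point \<beta> \<Gamma> x =
    \<beta> ^ n * word_sum \<Gamma> p + \<beta> ^ n * rep_point \<beta> \<Gamma> (\<lambda>m. x (Suc m))"
proof -
  have "\<beta> * rep_point \<beta> \<Gamma> x = word_sum \<Gamma> p + rep_point \<beta> \<Gamma> (\<lambda>m. x (Suc m))"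
    using assms rep_point_shift[of x b] \<beta>_nonzero by (auto simp: label_seqs_from_def)
  then show ?thesis by (simp add: distrib_left[symmetric])
qed

text \<open>
  The first \<open>n\<close> labels of \<open>x\<close> are the address of a position in \<open>\<sigma>\<^sup>n(b)\<close>: the first label selects
  a block, the second a block inside it, and so on.
\<close>

lemma point_near_prefix:
  assumes "x \<in> label_seqs \<sigma> b"
  shows "\<exists>k<length ((subst_word \<sigma> ^^ n) [b]).
    norm (word_sum \<Gamma> (take k ((subst_word \<sigma> ^^ n) [b])) - \<beta> ^ n * rep_point \<beta> \<Gamma> x) \<le> radius"
  using assms
proof (induction n arbitrary: b x)
  case 0
  then show ?case using rep_point_terms(2) by simp
next
  case (Suc n)
  obtain p c s where l: "x 0 = (p, c, s)" "\<sigma> b = p @ [c] @ s"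
    using Suc.prems by (auto simp: label_seqs_def labels_def)
  have x: "x \<in> label_seqs_from \<sigma> b (p, c, s)"
    using Suc.prems l by (simp add: label_seqs_from_def)
  have "(\<lambda>m. x (Suc m)) \<in> label_seqs \<sigma> c"
    using label_seqs_shift[OF Suc.prems] l by simp
  from Suc.IH[OF this] obtain j where j: "j < length ((subst_word \<sigma> ^^ n) [c])"
      "norm (word_sum \<Gamma> (take j ((subst_word \<sigma> ^^ n) [c]))
        - \<beta> ^ n * rep_point \<beta> \<Gamma> (\<lambda>m. x (Suc m))) \<le> radius"
    by blast
  show ?case
    using level_position_less[OF l(2) j(1)] j(2)
      word_sum_take_level[OF l(2) less_imp_le[OF j(1)]] rep_point_level[OF x, of n]
    by (intro exI[of _ "length ((subst_word \<sigma> ^^ n) p) + j"]) simp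
qed

text \<open>
  The induction step for \<open>prefix_near_point\<close>, which moreover retains the first label.
\<close>

lemma prefix_near_point_from:
  assumes near: "\<exists>y\<in>label_seqs \<sigma> c.
      norm (word_sum \<Gamma> (take j ((subst_word \<sigma> ^^ n) [c])) - \<beta> ^ n * rep_point \<beta> \<Gamma> y) \<le> radius"
    and l: "(p, c, s) \<in> labels \<sigma> b" and j: "j < length ((subst_word \<sigma> ^^ n) [c])"
  shows "\<exists>x\<in>label_seqs_from \<sigma> b (p, c, s).
    norm (word_sum \<Gamma> (take (length ((subst_word \<sigma> ^^ n) p) + j) ((subst_word \<sigma> ^^ Suc n) [b]))
      - \<beta> ^ Suc n * rep_point \<beta> \<Gamma> x) \<le> radius"
proof -
  from near obtain y where y: "y \<in> label_seqs \<sigma> c"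
      "norm (word_sum \<Gamma> (take j ((subst_word \<sigma> ^^ n) [c])) - \<beta> ^ n * rep_point \<beta> \<Gamma> y) \<le> radius"
    by blast
  have x: "case_nat (p, c, s) y \<in> label_seqs_from \<sigma> b (p, c, s)"
    using label_seqs_from_cons[OF l, of y] y(1) by simp
  have "\<sigma> b = p @ [c] @ s" using l by (simp add: labels_def)
  from word_sum_take_level[OF this less_imp_le[OF j]] rep_point_level[OF x, of n] y(2)
  show ?thesis by (intro bexI[OF _ x]) simp
qed

text \<open>
  The address of the position gives the first \<open>n\<close> labels; any continuation will do.
\<close>

lemma prefix_near_point:
  assumes "k < length ((subst_word \<sigma> ^^ n) [b])"
  shows "\<exists>x\<in>label_seqs \<sigma> b.
    norm (word_sum \<Gamma> (take k ((subst_word \<sigma> ^^ n) [b])) - \<beta> ^ n * rep_point \<beta> \<Gamma> x) \<le> radius"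
  using assms
proof (induction n arbitrary: b k)
  case 0
  obtain x where "x \<in> label_seqs \<sigma> b" using label_seqs_nonempty by blast
  then show ?case using rep_point_terms(2) 0 by auto
next
  case (Suc n)
  obtain p c s j where l: "(p, c, s) \<in> labels \<sigma> b"
      and k: "k = length ((subst_word \<sigma> ^^ n) p) + j" and j: "j < length ((subst_word \<sigma> ^^ n) [c])"
    using level_position_exists[OF Suc.prems] by blast
  show ?case
    using prefix_near_point_from[OF Suc.IH[OF j] l j] k by (auto simp: label_seqs_from_def)
qed

text \<open>
  Compare the value at the minimizing position with the value at a position near a minimal point of
  \<open>F\<^sub>b\<close>. Each of the two passages between prefix values and fractal points costs at most
  \<open>|z| radius\<close>, and \<open>Re (z \<beta>\<^bsup>n+1\<^esup> w)\<close> is \<open>|z| |\<beta>|\<^bsup>n+1\<^esup>\<close> times \<open>Re (\<tau> w)\<close>.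
\<close>

lemma min_position_label_near_optimal:
  assumes z: "z \<noteq> 0" and l: "(p, c, s) \<in> labels \<sigma> b"
    and j: "j < length ((subst_word \<sigma> ^^ n) [c])"
    and min: "length ((subst_word \<sigma> ^^ n) p) + j \<in> min_positions \<sigma> (z *s \<Gamma>) (Suc n) b"
    and \<tau>: "\<tau> = (\<beta> / of_real (norm \<beta>)) ^ Suc n * (z / of_real (norm z))"
  shows "min_Re \<tau> (fractal_from \<sigma> \<beta> \<Gamma> b (p, c, s))
    \<le> min_Re \<tau> (fractal \<sigma> \<beta> \<Gamma> b) + 2 * radius / norm \<beta> ^ Suc n"
proof -
  define \<rho> where "\<rho> = norm z * norm \<beta> ^ Suc n"
  have \<rho>: "\<rho> > 0" using z \<beta>_nonzero by (simp add: \<rho>_def)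
  define k where "k = length ((subst_word \<sigma> ^^ n) p) + j"
  define val where "val i = Re (z * word_sum \<Gamma> (take i ((subst_word \<sigma> ^^ Suc n) [b])))" for i
  have scale: "Re (z * (\<beta> ^ Suc n * w)) = \<rho> * Re (\<tau> * w)" for w
  proof -
    have "z * \<beta> ^ Suc n = of_real \<rho> * \<tau>"
      using z \<beta>_nonzero by (simp add: \<tau> \<rho>_def power_divide)
    then have "z * (\<beta> ^ Suc n * w) = of_real \<rho> * (\<tau> * w)" by (simp add: mult.assoc[symmetric])
    moreover have "Re (of_real \<rho> * v) = \<rho> * Re v" for v by simp
    ultimately show ?thesis by metis
  qed
  obtain w where w: "w \<in> fractal \<sigma> \<beta> \<Gamma> b" "Re (\<tau> * w) = min_Re \<tau> (fractal \<sigma> \<beta> \<Gamma> b)"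
    using min_Re_attained(1)[OF compact_fractal fractal_nonempty] by blast
  then obtain x where x: "x \<in> label_seqs \<sigma> b" "w = rep_point \<beta> \<Gamma> x"
    by (auto simp: fractal_def)
  obtain i where i: "i < length ((subst_word \<sigma> ^^ Suc n) [b])"
      "norm (word_sum \<Gamma> (take i ((subst_word \<sigma> ^^ Suc n) [b])) - \<beta> ^ Suc n * w) \<le> radius"
    using point_near_prefix[OF x(1)] x(2) by blast
  obtain y where y: "y \<in> label_seqs_from \<sigma> b (p, c, s)"
      "norm (word_sum \<Gamma> (take k ((subst_word \<sigma> ^^ Suc n) [b])) - \<beta> ^ Suc n * rep_point \<beta> \<Gamma> y) \<le> radius"
    using prefix_near_point_from[OF prefix_near_point[OF j] l j] unfolding k_def by blast
  have "val k \<le> val i"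
    using min i(1) unfolding min_positions_def val_def k_def word_sum_scale by blast
  moreover have "\<bar>val i - \<rho> * Re (\<tau> * w)\<bar> \<le> norm z * radius"
    using Re_scaled_close[OF i(2), of z] unfolding val_def scale .
  moreover have "\<bar>val k - \<rho> * Re (\<tau> * rep_point \<beta> \<Gamma> y)\<bar> \<le> norm z * radius"
    using Re_scaled_close[OF y(2), of z] unfolding val_def scale .
  ultimately have "\<rho> * Re (\<tau> * rep_point \<beta> \<Gamma> y) \<le> \<rho> * Re (\<tau> * w) + 2 * (norm z * radius)"
    by linarith
  also have "\<dots> = \<rho> * (Re (\<tau> * w) + 2 * radius / norm \<beta> ^ Suc n)"
    using \<beta>_nonzero by (simp add: \<rho>_def distrib_left)
  finally have "Re (\<tau> * rep_point \<beta> \<Gamma> y) \<le> Re (\<tau> * w) + 2 * radius / norm \<beta> ^ Suc n"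
    using \<rho> by (simp only: mult_le_cancel_left_pos)
  moreover have "min_Re \<tau> (fractal_from \<sigma> \<beta> \<Gamma> b (p, c, s)) \<le> Re (\<tau> * rep_point \<beta> \<Gamma> y)"
    using min_Re_attained(2)[OF compact_fractal_from fractal_from_nonempty[OF l]] y(1)
    by (auto simp: fractal_from_def)
  ultimately show ?thesis using w(2) by linarith
qed

lemma min_Re_fractal_le:
  assumes "l \<in> labels \<sigma> b"
  shows "min_Re \<tau> (fractal \<sigma> \<beta> \<Gamma> b) \<le> min_Re \<tau> (fractal_from \<sigma> \<beta> \<Gamma> b l)"
proof -
  obtain z where "z \<in> fractal_from \<sigma> \<beta> \<Gamma> b l" "Re (\<tau> * z) = min_Re \<tau> (fractal_from \<sigma> \<beta> \<Gamma> b l)"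
    using min_Re_attained(1)[OF compact_fractal_from fractal_from_nonempty[OF assms]] by blast
  then show ?thesis
    using min_Re_attained(2)[OF compact_fractal fractal_nonempty, of z b \<tau>] assms
    by (auto simp: fractal_split)
qed

text \<open>
  This is where the good direction and the unique representation property enter. Infinitely many near
  ties accumulate at a direction \<open>\<xi>\<close> in \<open>\<Psi>\<close>, and by the linear separation of the two minima near
  \<open>\<xi>\<close> they would approach \<open>\<xi>\<close> at the rate \<open>|\<beta>|\<^bsup>-n\<^esup>\<close>, which is too fast for a good direction.
\<close>

lemma finite_near_ties:
  fixes \<tau>0 :: complex and C :: real
  defines "\<tau> \<equiv> \<lambda>n. (\<beta> / of_real (norm \<beta>)) ^ n * \<tau>0"
  assumes urp: "unique_representation_property \<sigma> \<beta> \<Gamma>"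
    and good: "good_direction \<sigma> \<beta> \<Gamma> \<tau>0"
  defines "near \<equiv> \<lambda>n b l. l \<in> labels \<sigma> b \<and>
      min_Re (\<tau> n) (fractal_from \<sigma> \<beta> \<Gamma> b l) \<le> min_Re (\<tau> n) (fractal \<sigma> \<beta> \<Gamma> b) + C / norm \<beta> ^ n"
  shows "finite {n. \<exists>b l l'. l \<noteq> l' \<and> near n b l \<and> near n b l'}"
proof (rule ccontr)
  assume inf: "infinite {n. \<exists>b l l'. l \<noteq> l' \<and> near n b l \<and> near n b l'}"
  define L where "L = (\<Union>b. labels \<sigma> b)"
  have "finite L" by (simp add: L_def finite_labels)
  then have fin: "finite ((UNIV :: 'a set) \<times> L \<times> L)" by simp
  have near_L: "l \<in> L" if "near n b l" for n b l
    using that by (auto simp: L_def near_def)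
  have "\<exists>b l l'. infinite {n. l \<noteq> l' \<and> near n b l \<and> near n b l'}"
  proof (rule ccontr)
    assume "\<not> ?thesis"
    then have none: "finite {n. l \<noteq> l' \<and> near n b l \<and> near n b l'}" for b l l' by blast
    have fin_UN: "finite (\<Union>(b, l, l') \<in> UNIV \<times> L \<times> L. {n. l \<noteq> l' \<and> near n b l \<and> near n b l'})"
      by (rule finite_UN_I[OF fin]) (simp only: case_prod_unfold none)
    have sub: "{n. \<exists>b l l'. l \<noteq> l' \<and> near n b l \<and> near n b l'} \<subseteq>
        (\<Union>(b, l, l') \<in> UNIV \<times> L \<times> L. {n. l \<noteq> l' \<and> near n b l \<and> near n b l'})"
    proof
      fix n assume "n \<in> {n. \<exists>b l l'. l \<noteq> l' \<and> near n b l \<and> near n b l'}"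
      then obtain b l l' where "l \<noteq> l'" "near n b l" "near n b l'" by blast
      then show "n \<in> (\<Union>(b, l, l') \<in> UNIV \<times> L \<times> L. {n. l \<noteq> l' \<and> near n b l \<and> near n b l'})"
        using near_L by (intro UN_I[of "(b, l, l')"]) auto
    qed
    show False using inf finite_subset[OF sub fin_UN] by (rule notE)
  qed
  then obtain b l l' where inf': "infinite {n. l \<noteq> l' \<and> near n b l \<and> near n b l'}" by blast
  obtain r :: "nat \<Rightarrow> nat" where r: "strict_mono r"
      and r_tie: "\<And>j. l \<noteq> l' \<and> near (r j) b l \<and> near (r j) b l'"
    using infinite_enumerate[OF inf'] by blast
  have ll': "l \<noteq> l'" "l \<in> labels \<sigma> b" "l' \<in> labels \<sigma> b"
    using r_tie[of 0] by (auto simp: near_def)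
  have norm_\<tau>: "norm (\<tau> n) = 1" for n
    using good \<beta>_nonzero
    by (simp add: \<tau>_def good_direction_def norm_mult norm_power norm_divide)
  obtain \<xi> r' where \<xi>: "\<xi> \<in> sphere 0 1" and r': "strict_mono (r' :: nat \<Rightarrow> nat)"
      and lim: "((\<lambda>j. \<tau> (r j)) \<circ> r') \<longlonglongrightarrow> \<xi>"
    using seq_compactE[of "sphere (0::complex) 1" "\<lambda>j. \<tau> (r j)"] norm_\<tau>
    by (auto simp: compact_eq_seq_compact_metric[symmetric])
  define q where "q = r \<circ> r'"
  have q: "strict_mono q" unfolding q_def using r r' by (rule strict_mono_o)
  have q_near: "near (q j) b l" "near (q j) b l'" for j using r_tie by (auto simp: q_def)
  have lim_q: "(\<lambda>j. \<tau> (q j)) \<longlonglongrightarrow> \<xi>" using lim by (simp add: o_def q_def)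
  define F where "F = fractal \<sigma> \<beta> \<Gamma> b"
  define G where "G m = fractal_from \<sigma> \<beta> \<Gamma> b m" for m
  note F = compact_fractal[of b, folded F_def] fractal_nonempty[of b, folded F_def]
  have G: "compact (G m)" "m \<in> labels \<sigma> b \<Longrightarrow> G m \<noteq> {}" for m
    using compact_fractal_from fractal_from_nonempty by (auto simp: G_def)
  have gap_ge: "min_Re t F \<le> min_Re t (G m)" if "m \<in> labels \<sigma> b" for t m
    using min_Re_fractal_le[OF that] by (simp add: F_def G_def)
  have gap_le: "min_Re (\<tau> (q j)) (G m) - min_Re (\<tau> (q j)) F \<le> C / norm \<beta> ^ q j"
    if "m \<in> {l, l'}" for m j
    using q_near[of j] that by (auto simp: near_def F_def G_def)
  have "(\<lambda>n. C * (1 / norm \<beta>) ^ n) \<longlonglongrightarrow> C * 0"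
    using inverse_norm_less_1 by (intro tendsto_mult_left LIMSEQ_realpow_zero) auto
  then have "(\<lambda>n. C / norm \<beta> ^ n) \<longlonglongrightarrow> 0" by (simp add: power_one_over)
  from LIMSEQ_subseq_LIMSEQ[OF this q] have vanish: "(\<lambda>j. C / norm \<beta> ^ q j) \<longlonglongrightarrow> 0"
    by (simp add: o_def)
  have tie: "min_Re \<xi> F = min_Re \<xi> (G m)" if m: "m \<in> {l, l'}" for m
  proof -
    have m': "m \<in> labels \<sigma> b" using m ll' by auto
    have "(\<lambda>j. min_Re (\<tau> (q j)) (G m) - min_Re (\<tau> (q j)) F) \<longlonglongrightarrow> min_Re \<xi> (G m) - min_Re \<xi> F"
      by (intro tendsto_diff min_Re_tendsto F G m' lim_q)
    then have "min_Re \<xi> (G m) - min_Re \<xi> F \<le> 0"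
      by (rule LIMSEQ_le[OF _ vanish]) (use gap_le[OF m] in blast)
    then show ?thesis using gap_ge[OF m', of \<xi>] by linarith
  qed
  have \<xi>_Psi: "\<xi> \<in> Psi \<sigma> \<beta> \<Gamma>"
    using \<xi> ll' tie[of l] tie[of l'] unfolding Psi_def Psi_at_def F_def G_def by blast
  \<comment> \<open>A common minimal point would be extreme in \<open>F\<close> and have representations starting with
    different labels.\<close>
  have disjoint: "Re (\<xi> * z) \<noteq> min_Re \<xi> (G l)" if z: "z \<in> G l" "z \<in> G l'" for z
  proof
    assume eq: "Re (\<xi> * z) = min_Re \<xi> (G l)"
    obtain x x' where x: "x \<in> label_seqs_from \<sigma> b l" "z = rep_point \<beta> \<Gamma> x"
        "x' \<in> label_seqs_from \<sigma> b l'" "z = rep_point \<beta> \<Gamma> x'"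
      using z by (auto simp: G_def fractal_from_def)
    then have xs: "x \<in> label_seqs \<sigma> b" "x' \<in> label_seqs \<sigma> b" "x 0 = l" "x' 0 = l'"
      by (auto simp: label_seqs_from_def)
    have "extreme_point F \<xi> z"
      using eq tie[of l] xs x by (auto simp: extreme_point_def F_def fractal_def)
    then have "\<exists>!x. x \<in> label_seqs \<sigma> b \<and> rep_point \<beta> \<Gamma> x = z"
      using urp \<xi> unfolding unique_representation_property_def F_def by blast
    then have "x = x'" using x(2,4) xs(1,2) by (elim ex1E) metis
    then show False using xs ll' by simp
  qed
  have "min_Re \<xi> (G l) = min_Re \<xi> (G l')" using tie[of l] tie[of l'] by simp
  from support_functions_separate_linearly[OF G(1) G(2)[OF ll'(2)] G(1) G(2)[OF ll'(3)] _ _ lim_q this disjoint]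
  obtain c and u :: "nat \<Rightarrow> nat" where c: "c > 0" and u: "strict_mono u"
      and sep: "\<And>j. c * \<bar>Im (\<tau> (q (u j)) / \<xi>)\<bar>
        \<le> \<bar>min_Re (\<tau> (q (u j))) (G l) - min_Re (\<tau> (q (u j))) (G l')\<bar>"
    using \<xi> norm_\<tau> by auto
  have qu: "strict_mono (\<lambda>j. q (u j))" using strict_mono_o[OF q u] by (simp add: o_def)
  obtain A where A: "1 < A" "A < norm \<beta>"
      and liminf: "liminf (\<lambda>n. ereal (A ^ n * arc_dist \<xi> (\<tau> n))) = \<infinity>"
    using good \<xi>_Psi unfolding good_direction_def \<tau>_def by blast
  \<comment> \<open>The bound for \<open>|\<beta>|\<^sup>n\<close> times the arc-length distance to \<open>\<xi>\<close> that the separation gives.\<close>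
  define K where "K = 2 * \<bar>C\<bar> / c"
  have K: "K \<ge> 0" using c by (simp add: K_def)
  have "(\<lambda>n. ereal (A ^ n * arc_dist \<xi> (\<tau> n))) \<longlonglongrightarrow> \<infinity>"
    using liminf by (subst Liminf_PInfty) auto
  then have "\<forall>\<^sub>F n in sequentially. ereal K < ereal (A ^ n * arc_dist \<xi> (\<tau> n))"
    unfolding tendsto_PInfty by blast
  then have far: "\<forall>\<^sub>F j in sequentially. K < A ^ q (u j) * arc_dist \<xi> (\<tau> (q (u j)))"
    using eventually_subseq[OF qu] by simp
  have \<xi>0: "\<xi> \<noteq> 0" using \<xi> by auto
  have "(\<lambda>j. \<tau> (q (u j))) \<longlonglongrightarrow> \<xi>" using LIMSEQ_subseq_LIMSEQ[OF lim_q u] by (simp add: o_def)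
  then have "(\<lambda>j. Re (\<tau> (q (u j)) / \<xi>)) \<longlonglongrightarrow> Re (\<xi> / \<xi>)"
    by (intro tendsto_intros \<xi>0)
  then have "(\<lambda>j. Re (\<tau> (q (u j)) / \<xi>)) \<longlonglongrightarrow> 1" using \<xi>0 by simp
  then have "\<forall>\<^sub>F j in sequentially. 1 / 2 < Re (\<tau> (q (u j)) / \<xi>)"
    by (rule order_tendstoD) simp
  with far have "\<forall>\<^sub>F j in sequentially. False"
  proof eventually_elim
    case (elim j)
    define n where "n = q (u j)"
    have "c * \<bar>Im (\<tau> n / \<xi>)\<bar> \<le> \<bar>min_Re (\<tau> n) (G l) - min_Re (\<tau> n) (G l')\<bar>"
      using sep[of j] by (simp only: n_def)
    also have "\<dots> \<le> C / norm \<beta> ^ n"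
      using gap_le[of l "u j"] gap_le[of l' "u j"] gap_ge[OF ll'(2), of "\<tau> n"]
        gap_ge[OF ll'(3), of "\<tau> n"] unfolding n_def by auto
    also have "\<dots> \<le> \<bar>C\<bar> / norm \<beta> ^ n" by (intro divide_right_mono) auto
    finally have "\<bar>Im (\<tau> n / \<xi>)\<bar> \<le> \<bar>C\<bar> / norm \<beta> ^ n / c"
      using c by (simp only: pos_le_divide_eq mult.commute)
    then have "arc_dist \<xi> (\<tau> n) \<le> 2 * (\<bar>C\<bar> / norm \<beta> ^ n / c)"
      using arc_dist_le_Im[of \<xi> "\<tau> n"] elim(2) \<xi> norm_\<tau> n_def by auto
    also have "\<dots> = K / norm \<beta> ^ n" by (simp add: K_def)
    finally have "A ^ n * arc_dist \<xi> (\<tau> n) \<le> A ^ n * (K / norm \<beta> ^ n)"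
      using A by (intro mult_left_mono) auto
    also have "\<dots> = (A ^ n / norm \<beta> ^ n) * K" by simp
    also have "\<dots> \<le> 1 * K"
    proof (intro mult_right_mono K)
      have "A ^ n \<le> norm \<beta> ^ n" "0 < norm \<beta> ^ n"
        using A expanding \<beta>_nonzero by (auto intro: power_mono)
      then show "A ^ n / norm \<beta> ^ n \<le> 1" by (simp only: divide_le_eq_1_pos)
    qed
    finally show False using elim(1) n_def by simp
  qed
  then show False by simp
qed

text \<open>
  Beyond the last near tie all minimizing positions of \<open>\<sigma>\<^bsup>n+1\<^esup>(b)\<close> lie in the block of one label
  \<open>(p, c, s)\<close> and come from minimizing positions of \<open>\<sigma>\<^sup>n(c)\<close>. So the largest number of minimizing
  positions for one letter does not increase from that level on.
\<close>

lemma card_min_positions_bounded: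
  assumes urp: "unique_representation_property \<sigma> \<beta> \<Gamma>" and z: "z \<noteq> 0"
    and good: "good_direction \<sigma> \<beta> \<Gamma> (z / of_real (norm z))"
  shows "\<exists>K. \<forall>n b. card (min_positions \<sigma> (z *s \<Gamma>) n b) \<le> K"
proof -
  define near where "near n b l \<longleftrightarrow> l \<in> labels \<sigma> b \<and>
      min_Re ((\<beta> / of_real (norm \<beta>)) ^ n * (z / of_real (norm z))) (fractal_from \<sigma> \<beta> \<Gamma> b l)
      \<le> min_Re ((\<beta> / of_real (norm \<beta>)) ^ n * (z / of_real (norm z))) (fractal \<sigma> \<beta> \<Gamma> b)
        + 2 * radius / norm \<beta> ^ n" for n b l
  have "finite {n. \<exists>b l l'. l \<noteq> l' \<and> near n b l \<and> near n b l'}"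
    using finite_near_ties[OF urp good, of "2 * radius"] unfolding near_def .
  then obtain N where N: "\<And>n b l l'. n > N \<Longrightarrow> near n b l \<Longrightarrow> near n b l' \<Longrightarrow> l = l'"
    by (auto simp: finite_nat_set_iff_bounded_le leD) (metis leD)
  define mp where "mp n b = min_positions \<sigma> (z *s \<Gamma>) n b" for n b
  define K where "K = Max ((\<lambda>(n, b). card (mp n b)) ` ({..N} \<times> UNIV))"
  have "card (mp n b) \<le> K" for n b
  proof (induction n arbitrary: b)
    case 0
    have "card (mp 0 b) \<in> (\<lambda>(n, b). card (mp n b)) ` ({..N} \<times> UNIV)" by force
    then show ?case unfolding K_def by (intro Max_ge) auto
  next
    case (Suc n)
    show ?case
    proof (cases "Suc n \<le> N")
      case True
      then have "card (mp (Suc n) b) \<in> (\<lambda>(n, b). card (mp n b)) ` ({..N} \<times> UNIV)" by force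
      then show ?thesis unfolding K_def by (intro Max_ge) auto
    next
      case False
      show ?thesis
      proof (cases "mp (Suc n) b = {}")
        case False
        have decomp: "\<exists>p c s j. near (Suc n) b (p, c, s) \<and> (p, c, s) \<in> labels \<sigma> b \<and>
            j < length ((subst_word \<sigma> ^^ n) [c]) \<and> k = length ((subst_word \<sigma> ^^ n) p) + j"
          if k: "k \<in> mp (Suc n) b" for k
        proof -
          have "k < length ((subst_word \<sigma> ^^ Suc n) [b])"
            using k unfolding mp_def min_positions_def by blast
          from level_position_exists[OF this] obtain p c s j where l: "(p, c, s) \<in> labels \<sigma> b"
              and kj: "k = length ((subst_word \<sigma> ^^ n) p) + j"
              and j: "j < length ((subst_word \<sigma> ^^ n) [c])" by blast
          have "near (Suc n) b (p, c, s)"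
            using min_position_label_near_optimal[OF z l j k[unfolded mp_def kj] refl] l
            unfolding near_def by blast
          then show ?thesis using l kj j by blast
        qed
        obtain p c s where near: "near (Suc n) b (p, c, s)" and l: "(p, c, s) \<in> labels \<sigma> b"
          using decomp False by blast
        have pcs: "\<sigma> b = p @ [c] @ s" using l by (simp add: labels_def)
        have "mp (Suc n) b \<subseteq> (\<lambda>j. length ((subst_word \<sigma> ^^ n) p) + j) ` mp n c"
        proof
          fix k assume k: "k \<in> mp (Suc n) b"
          from decomp[OF this] obtain p' c' s' j where near': "near (Suc n) b (p', c', s')"
              and kj': "j < length ((subst_word \<sigma> ^^ n) [c'])" "k = length ((subst_word \<sigma> ^^ n) p') + j"
            by blast
          have "(p', c', s') = (p, c, s)" using N[OF _ near' near] \<open>\<not> Suc n \<le> N\<close> by simp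
          then have j: "j < length ((subst_word \<sigma> ^^ n) [c])"
              and kj: "k = length ((subst_word \<sigma> ^^ n) p) + j" using kj' by auto
          have "j \<in> mp n c"
            unfolding mp_def min_positions_def
          proof (intro CollectI conjI allI impI j)
            fix i assume i: "i < length ((subst_word \<sigma> ^^ n) [c])"
            have "Re (z * word_sum \<Gamma> (take (length ((subst_word \<sigma> ^^ n) p) + j) ((subst_word \<sigma> ^^ Suc n) [b])))
                \<le> Re (z * word_sum \<Gamma> (take (length ((subst_word \<sigma> ^^ n) p) + i) ((subst_word \<sigma> ^^ Suc n) [b])))"
              using k level_position_less[OF pcs i]
              unfolding mp_def min_positions_def kj word_sum_scale by blast
            then show "Re (word_sum (z *s \<Gamma>) (take j ((subst_word \<sigma> ^^ n) [c])))
                \<le> Re (word_sum (z *s \<Gamma>) (take i ((subst_word \<sigma> ^^ n) [c])))"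
              unfolding word_sum_take_level[OF pcs less_imp_le[OF i]]
                word_sum_take_level[OF pcs less_imp_le[OF j]] word_sum_scale distrib_left plus_complex.simps
              by linarith
          qed
          then show "k \<in> (\<lambda>j. length ((subst_word \<sigma> ^^ n) p) + j) ` mp n c" using kj by blast
        qed
        moreover have "finite (mp n c)" unfolding mp_def by (rule finite_min_positions)
        ultimately have "card (mp (Suc n) b) \<le> card (mp n c)" by (rule surj_card_le[rotated])
        then show ?thesis using Suc.IH[of c] by linarith
      qed simp
    qed
  qed
  then show ?thesis unfolding mp_def by blast
qed

end


section \<open>Windows of minimal sequences\<close>

context expanding_eigenvector
begin

text \<open>
  If \<open>\<Gamma>\<^sub>a\<close> is not 0, then \<open>|\<Gamma>(\<sigma>\<^sup>n(a))| = |\<beta>|\<^sup>n |\<Gamma>\<^sub>a|\<close> is unbounded, and so is the length of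
  \<open>\<sigma>\<^sup>n(a)\<close>. By primitivity \<open>a\<close> occurs in some fixed iterated image of every letter.
\<close>

lemma letter_images_grow:
  assumes "\<Gamma> \<noteq> 0" and "primitive_subst \<sigma>"
  shows "\<exists>n. \<forall>b. L \<le> length ((subst_word \<sigma> ^^ n) [b])"
proof -
  obtain a where a: "\<Gamma> $ a \<noteq> 0" using assms(1) by (auto simp: vec_eq_iff)
  define B where "B = (\<Sum>b\<in>UNIV. norm (\<Gamma> $ b))"
  have comp_le: "norm (\<Gamma> $ b) \<le> B" for b
    unfolding B_def by (rule member_le_sum) auto
  have B: "B > 0" using a comp_le[of a] zero_less_norm_iff[of "\<Gamma> $ a"] by linarith
  have sum_le: "norm (word_sum \<Gamma> w) \<le> B * length w" for w
  proof -
    have "(\<Sum>b\<leftarrow>w. norm (\<Gamma> $ b)) \<le> (\<Sum>b\<leftarrow>w. B)"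
      by (rule sum_list_mono) (rule comp_le)
    then show ?thesis using norm_word_sum_le[of \<Gamma> w] by (simp add: sum_list_triv mult.commute)
  qed
  obtain n where n: "B * L / norm (\<Gamma> $ a) < norm \<beta> ^ n"
    using real_arch_pow[OF expanding] by blast
  have "norm (word_sum \<Gamma> ((subst_word \<sigma> ^^ n) [a])) = norm \<beta> ^ n * norm (\<Gamma> $ a)"
    by (simp add: word_sum_subst_pow[OF eigen] norm_mult norm_power) (simp add: word_sum_def)
  then have "B * L < B * length ((subst_word \<sigma> ^^ n) [a])"
    using n a sum_le[of "(subst_word \<sigma> ^^ n) [a]"] by (simp add: divide_less_eq)
  then have L: "L < length ((subst_word \<sigma> ^^ n) [a])" using B by simp
  obtain m where "\<forall>b c. c \<in> set ((subst_word \<sigma> ^^ m) [b])"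
    using assms(2) unfolding primitive_subst_def by (elim exE conjE) (rule that)
  then have m: "c \<in> set ((subst_word \<sigma> ^^ m) [b])" for b c by simp
  have "L \<le> length ((subst_word \<sigma> ^^ (n + m)) [b])" for b
  proof -
    obtain u v where "(subst_word \<sigma> ^^ m) [b] = u @ [a] @ v"
      using split_list[OF m[of a b]] by auto
    then have "(subst_word \<sigma> ^^ (n + m)) [b] =
        (subst_word \<sigma> ^^ n) u @ (subst_word \<sigma> ^^ n) [a] @ (subst_word \<sigma> ^^ n) v"
      by (simp only: funpow_add o_apply subst_pow_append)
    then show ?thesis using L by simp
  qed
  then show ?thesis by blast
qed

end

text \<open>
  The block \<open>\<sigma>\<^sup>n(b)\<close> contains the origin at its position \<open>k\<close>. The adjacent blocks are recorded too,
  because \<open>k\<close> may be close to either end of the middle block.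
\<close>

definition window_at :: "('a \<Rightarrow> 'a list) \<Rightarrow> nat \<Rightarrow> (int \<Rightarrow> 'a) \<Rightarrow> 'a \<times> 'a \<times> 'a \<times> nat \<Rightarrow> bool" where
  "window_at \<sigma> n \<omega> = (\<lambda>(d, b, e, k).
     k < length ((subst_word \<sigma> ^^ n) [b]) \<and>
     (\<forall>i < length ((subst_word \<sigma> ^^ n) [d, b, e]).
        \<omega> (int i - int (length ((subst_word \<sigma> ^^ n) [d])) - int k) = (subst_word \<sigma> ^^ n) [d, b, e] ! i))"

text \<open>
  A sufficiently long factor of \<open>\<omega>\<close> around the origin occurs in some \<open>\<sigma>\<^sup>m(a)\<close>. This word is longer
  than all \<open>\<sigma>\<^sup>n\<close>-images of letters, which forces \<open>m \<ge> n\<close>; so it is a concatenation of blocks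
  \<open>\<sigma>\<^sup>n(c)\<close>, and the block containing the origin has a neighbour on either side.
\<close>

lemma window_exists:
  fixes \<sigma> :: "'a::finite \<Rightarrow> 'a list"
  assumes nonempty: "\<And>a. \<sigma> a \<noteq> []" and \<omega>: "\<omega> \<in> subshift \<sigma>"
  shows "\<exists>t. window_at \<sigma> n \<omega> t"
proof -
  define S where "S m w = (subst_word \<sigma> ^^ m) w" for m w
  define M where "M = Max (range (\<lambda>a. length (S n [a])))"
  have M: "length (S n [a]) \<le> M" for a
    unfolding M_def by (rule Max_ge) auto
  have "1 \<le> length (S n [a])" for a
    using length_subst_pow_mono[of \<sigma> 0 n "[a]"] nonempty by (simp add: S_def)
  then have M1: "1 \<le> M" using M le_trans by blast
  \<comment> \<open>The three blocks extend less than \<open>2 M\<close> to either side of the origin.\<close>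
  define win where "win = map \<omega> [- 2 * int M..2 * int M]"
  have len_win: "length win = 4 * M + 1" by (simp add: win_def)
  have win_nth: "win ! i = \<omega> (int i - 2 * int M)" if "i < 4 * M + 1" for i
  proof -
    have "[- 2 * int M..2 * int M] ! i = - 2 * int M + int i"
      using that by (intro nth_upto) simp
    then show ?thesis using that by (simp add: win_def)
  qed
  obtain m a where "sublist win (S m [a])"
    using \<omega> unfolding subshift_def win_def S_def by blast
  then obtain pre suf where host: "S m [a] = pre @ win @ suf" by (auto simp: sublist_def)
  have "n \<le> m"
  proof (rule ccontr)
    assume "\<not> n \<le> m"
    then have "length (S m [a]) \<le> length (S n [a])"
      unfolding S_def by (intro length_subst_pow_mono nonempty) simp
    then show False using M[of a] host len_win by simp
  qed
  define w where "w = S (m - n) [a]"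
  have host': "S n w = pre @ win @ suf"
    using host \<open>n \<le> m\<close> by (simp add: S_def w_def funpow_add[symmetric, THEN fun_cong, simplified o_apply])
  \<comment> \<open>The position of the origin in \<open>S n w\<close>.\<close>
  define q where "q = length pre + 2 * M"
  have "q < length (S n w)" using host' len_win by (simp add: q_def)
  from subst_pow_locate[OF this[unfolded S_def]]
  obtain p b s k where w: "w = p @ [b] @ s" and q: "q = length (S n p) + k" and k: "k < length (S n [b])"
    unfolding S_def by blast
  have kM: "k < M" using k M[of b] by simp
  have S_append: "S n (u @ v) = S n u @ S n v" for u v by (simp add: S_def subst_pow_append)
  have S_Nil: "S n [] = []" by (simp add: S_def subst_pow_Nil)
  have "p \<noteq> []"
  proof
    assume "p = []"
    then show False using q kM by (simp add: S_Nil q_def)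
  qed
  then obtain p' d where p: "p = p' @ [d]" by (cases p rule: rev_cases) auto
  have "s \<noteq> []"
  proof
    assume "s = []"
    then have "length (S n w) = length (S n p) + length (S n [b])"
      by (simp only: w S_append S_Nil) simp
    then show False using q M[of b] M1 len_win host' by (simp add: q_def)
  qed
  then obtain e s' where s: "s = e # s'" by (cases s) auto
  have split: "S n w = S n p' @ S n [d, b, e] @ S n s'"
  proof -
    have "w = p' @ [d, b, e] @ s'" using w p s by simp
    then show ?thesis by (simp only: S_append)
  qed
  have len3: "length (S n [d, b, e]) = length (S n [d]) + length (S n [b]) + length (S n [e])"
    using S_append[of "[d]" "[b, e]"] S_append[of "[b]" "[e]"] by simp
  have q': "q = length (S n p') + length (S n [d]) + k" using q p by (simp add: S_append)
  have "\<omega> (int i - int (length (S n [d])) - int k) = S n [d, b, e] ! i"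
    if i: "i < length (S n [d, b, e])" for i
  proof -
    have "i < 3 * M + 1" using i len3 M[of d] M[of b] M[of e] by linarith
    define j where "j = length (S n p') + i - length pre"
    have j: "length (S n p') + i = length pre + j" and j_int: "int j = int i + 2 * int M - int (length (S n [d])) - int k"
      using q' q_def kM M[of d] M1 by (auto simp: j_def)
    have "j < 4 * M + 1"
      using j_int i len3 k M[of b] M[of e] by linarith
    have "S n [d, b, e] ! i = S n w ! (length (S n p') + i)"
      unfolding split using i by (simp add: nth_append)
    also have "\<dots> = win ! j"
      unfolding host' j using \<open>j < 4 * M + 1\<close> len_win by (simp add: nth_append)
    also have "\<dots> = \<omega> (int j - 2 * int M)" using \<open>j < 4 * M + 1\<close> by (rule win_nth)
    also have "int j - 2 * int M = int i - int (length (S n [d])) - int k"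
      using j_int by simp
    finally show ?thesis by simp
  qed
  then have "window_at \<sigma> n \<omega> (d, b, e, k)"
    using k by (simp add: window_at_def S_def)
  then show ?thesis by blast
qed

lemma window_determines:
  assumes "window_at \<sigma> n \<omega> t" "window_at \<sigma> n \<omega>' t"
    and L: "\<And>a. L \<le> length ((subst_word \<sigma> ^^ n) [a])"
    and i: "\<bar>i\<bar> < int L"
  shows "\<omega> i = \<omega>' i"
proof -
  obtain d b e k where t: "t = (d, b, e, k)" by (cases t)
  have len3: "length ((subst_word \<sigma> ^^ n) [d, b, e]) = length ((subst_word \<sigma> ^^ n) [d])
      + length ((subst_word \<sigma> ^^ n) [b]) + length ((subst_word \<sigma> ^^ n) [e])"
    using subst_pow_append[of n \<sigma> "[d]" "[b, e]"] subst_pow_append[of n \<sigma> "[b]" "[e]"] by simp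
  define j where "j = nat (i + int (length ((subst_word \<sigma> ^^ n) [d])) + int k)"
  have k: "k < length ((subst_word \<sigma> ^^ n) [b])" using assms(1) by (simp add: t window_at_def)
  have i_eq: "i = int j - int (length ((subst_word \<sigma> ^^ n) [d])) - int k"
    using i L[of d] by (simp add: j_def)
  have "j < length ((subst_word \<sigma> ^^ n) [d, b, e])"
    using i_eq i len3 L[of e] k by linarith
  then show ?thesis
    using assms(1,2) unfolding t window_at_def i_eq by simp
qed

text \<open>
  For a position \<open>j\<close> of the middle block, the Birkhoff sum of \<open>\<omega>\<close> at \<open>j - k\<close> is the difference of
  the values of the prefixes of lengths \<open>j\<close> and \<open>k\<close>, whatever the sign of \<open>j - k\<close>.
\<close>

lemma window_min_position:
  assumes "minimal_sequence \<gamma> \<omega>" and t: "window_at \<sigma> n \<omega> (d, b, e, k)"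
  shows "k \<in> min_positions \<sigma> \<gamma> n b"
proof -
  define W where "W = (subst_word \<sigma> ^^ n) [b]"
  define D where "D = length ((subst_word \<sigma> ^^ n) [d])"
  have k: "k < length W" using t by (simp add: window_at_def W_def)
  have dbe: "(subst_word \<sigma> ^^ n) [d, b, e] = (subst_word \<sigma> ^^ n) [d] @ W @ (subst_word \<sigma> ^^ n) [e]"
    using subst_pow_append[of n \<sigma> "[d]" "[b, e]"] subst_pow_append[of n \<sigma> "[b]" "[e]"]
    by (simp add: W_def)
  have \<omega>: "\<omega> (int i - int k) = W ! i" if "i < length W" for i
  proof -
    have "D + i < length ((subst_word \<sigma> ^^ n) [d, b, e])" using that by (simp add: dbe D_def)
    with t have "\<omega> (int (D + i) - int D - int k) = (subst_word \<sigma> ^^ n) [d, b, e] ! (D + i)"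
      unfolding window_at_def D_def by blast
    then show ?thesis using that by (simp add: dbe D_def nth_append)
  qed
  have word: "map \<omega> [int i - int k..int j - int k - 1] = take (j - i) (drop i W)"
    if "i \<le> j" "j \<le> length W" for i j
    using that by (intro nth_equalityI) (auto simp: nth_upto \<omega>[symmetric] algebra_simps)
  have "Re (word_sum \<gamma> (take k W)) \<le> Re (word_sum \<gamma> (take j W))" if j: "j < length W" for j
  proof -
    have "0 \<le> Re (birkhoff_sum \<gamma> \<omega> (int j - int k))"
      using assms(1) by (simp add: minimal_sequence_def)
    moreover have "birkhoff_sum \<gamma> \<omega> (int j - int k) = word_sum \<gamma> (take j W) - word_sum \<gamma> (take k W)"
    proof (cases "k \<le> j")
      case True
      have "take j W = take k W @ take (j - k) (drop k W)"
        using True take_add[of k "j - k" W] by simp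
      then show ?thesis
        using word[of k j] True j by (simp add: birkhoff_sum_def word_sum_append)
    next
      case False
      have "take k W = take j W @ take (k - j) (drop j W)"
        using False take_add[of j "k - j" W] by simp
      then show ?thesis
        using word[of j k] False k by (simp add: birkhoff_sum_def word_sum_append)
    qed
    ultimately show ?thesis by simp
  qed
  then show ?thesis using k by (simp add: min_positions_def W_def)
qed

lemma finite_functions_separated:
  fixes W :: "(int \<Rightarrow> 'b) set"
  assumes "finite W"
  shows "\<exists>L. \<forall>f\<in>W. \<forall>g\<in>W. (\<forall>i. \<bar>i\<bar> < int L \<longrightarrow> f i = g i) \<longrightarrow> f = g"
proof -
  define h where "h = (\<lambda>(f :: int \<Rightarrow> 'b, g). SOME i. f i \<noteq> g i)"
  define L where "L = Suc (Max (insert 0 ((\<lambda>p. nat \<bar>h p\<bar>) ` (W \<times> W))))"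
  have "f = g" if fg: "f \<in> W" "g \<in> W" and eq: "\<forall>i. \<bar>i\<bar> < int L \<longrightarrow> f i = g i" for f g
  proof (rule ccontr)
    assume "f \<noteq> g"
    then have "\<exists>i. f i \<noteq> g i" by auto
    from someI_ex[OF this] have ne: "f (h (f, g)) \<noteq> g (h (f, g))" by (simp add: h_def)
    have "nat \<bar>h (f, g)\<bar> \<le> Max (insert 0 ((\<lambda>p. nat \<bar>h p\<bar>) ` (W \<times> W)))"
      using fg assms by (intro Max_ge) auto
    then have "\<bar>h (f, g)\<bar> < int L" by (simp add: L_def)
    then show False using eq ne by blast
  qed
  then show ?thesis by blast
qed

theorem corollary3p5:
  fixes T :: "real \<Rightarrow> real"
    and J :: "'a::finite \<Rightarrow> real set"
    and \<delta> :: "real ^ 'a"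
    and \<alpha> :: real
    and \<sigma> :: "'a \<Rightarrow> 'a list"
    and \<beta> :: complex
    and \<Gamma> \<gamma> :: "complex ^ 'a"
  assumes "interval_exchange T J \<delta>"
    and "minimal_iem T"
    and "self_similar T \<alpha>"
    and "associated_substitution T J \<alpha> \<sigma>"
    and "primitive_subst \<sigma>"
    and "norm \<beta> > 1"
    and "\<forall>n>0. (\<beta> / of_real (norm \<beta>)) ^ n \<noteq> 1"
    and "is_eigenvector (subst_matrix \<sigma>) \<beta> \<Gamma>"
    and "unique_representation_property \<sigma> \<beta> \<Gamma>"
    and "good_eigenvector \<sigma> \<beta> \<Gamma> \<gamma>"
  shows "finite {\<omega> \<in> subshift \<sigma>. minimal_sequence \<gamma> \<omega>}"
proof -
  have nonempty: "\<sigma> a \<noteq> []" for a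
    using assms(4) by (simp add: associated_substitution_def)
  interpret expanding_eigenvector \<sigma> \<beta> \<Gamma>
    using nonempty assms(6,8) by unfold_locales (auto simp: is_eigenvector_def)
  obtain z where z: "z \<noteq> 0" "\<gamma> = z *s \<Gamma>" "good_direction \<sigma> \<beta> \<Gamma> (z / of_real (norm z))"
    using assms(10) by (auto simp: good_eigenvector_def)
  obtain K where K: "\<And>n b. card (min_positions \<sigma> \<gamma> n b) \<le> K"
    using card_min_positions_bounded[OF assms(9) z(1,3)] z(2) by blast
  define \<Omega> where "\<Omega> = {\<omega> \<in> subshift \<sigma>. minimal_sequence \<gamma> \<omega>}"
  define bound where "bound = (\<Sum>p\<in>(UNIV :: ('a \<times> 'a \<times> 'a) set). K)"
  \<comment> \<open>For \<open>n\<close> large enough the windows tell the members of \<open>W\<close> apart, and there are at most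
    \<open>bound\<close> windows whose position is minimizing.\<close>
  have small: "card W \<le> bound" if W: "finite W" "W \<subseteq> \<Omega>" for W
  proof -
    obtain L where L: "\<And>f g. f \<in> W \<Longrightarrow> g \<in> W \<Longrightarrow> (\<And>i. \<bar>i\<bar> < int L \<Longrightarrow> f i = g i) \<Longrightarrow> f = g"
      using finite_functions_separated[OF W(1)] by blast
    obtain n where n: "\<And>b. L \<le> length ((subst_word \<sigma> ^^ n) [b])"
      using letter_images_grow[OF _ assms(5), of L] assms(8) by (auto simp: is_eigenvector_def)
    have "\<forall>\<omega>\<in>W. \<exists>t. window_at \<sigma> n \<omega> t"
      using window_exists[OF nonempty] W(2) by (auto simp: \<Omega>_def)
    then obtain t where t: "\<And>\<omega>. \<omega> \<in> W \<Longrightarrow> window_at \<sigma> n \<omega> (t \<omega>)" by metis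
    define X where "X = (SIGMA p : (UNIV :: ('a \<times> 'a \<times> 'a) set). min_positions \<sigma> \<gamma> n (fst (snd p)))"
    have "inj_on (\<lambda>\<omega>. case t \<omega> of (d, b, e, k) \<Rightarrow> ((d, b, e), k)) W"
    proof (rule inj_onI)
      fix f g assume fg: "f \<in> W" "g \<in> W"
        and "(case t f of (d, b, e, k) \<Rightarrow> ((d, b, e), k)) = (case t g of (d, b, e, k) \<Rightarrow> ((d, b, e), k))"
      then have "t f = t g" by (auto split: prod.splits)
      then show "f = g" using L[OF fg] window_determines[OF t[OF fg(1)] _ n] t[OF fg(2)] by metis
    qed
    moreover have "(\<lambda>\<omega>. case t \<omega> of (d, b, e, k) \<Rightarrow> ((d, b, e), k)) ` W \<subseteq> X"
    proof (rule image_subsetI)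
      fix \<omega> assume \<omega>: "\<omega> \<in> W"
      obtain d b e k where tk: "t \<omega> = (d, b, e, k)" by (cases "t \<omega>")
      have "k \<in> min_positions \<sigma> \<gamma> n b"
        using window_min_position[of \<gamma> \<omega> \<sigma> n d b e k] t[OF \<omega>] \<omega> W(2) tk by (auto simp: \<Omega>_def)
      then show "(case t \<omega> of (d, b, e, k) \<Rightarrow> ((d, b, e), k)) \<in> X"
        by (simp add: X_def tk)
    qed
    moreover have "finite X" unfolding X_def by (intro finite_SigmaI finite_min_positions) simp
    ultimately have "card W \<le> card X" by (rule card_inj_on_le)
    also have "card X = (\<Sum>p\<in>(UNIV :: ('a \<times> 'a \<times> 'a) set). card (min_positions \<sigma> \<gamma> n (fst (snd p))))"
      unfolding X_def by (subst card_SigmaI) (simp_all add: finite_min_positions)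
    also have "\<dots> \<le> bound"
      unfolding bound_def by (intro sum_mono) (rule K)
    finally show ?thesis .
  qed
  have "finite \<Omega>"
  proof (rule ccontr)
    assume "infinite \<Omega>"
    then obtain W where "finite W" "card W = Suc bound" "W \<subseteq> \<Omega>"
      using infinite_arbitrarily_large by metis
    then show False using small[of W] by simp
  qed
  then show ?thesis by (simp only: \<Omega>_def)
qed

end
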